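(* Let $a(z)\not\equiv 0$ and $b(z)$ be rational functions of $z$, and let $w(z)$ be a non-rational meromorphic solution (meromorphic in the whole complex plane) of $$w(z+1)-w(z-1)+a(z)\frac{w'(z)}{w(z)}=b(z).$$ If the hyper-order $\rho_2(w)$ of $w$ is strictly less than one and for some $\epsilon>0$ $$\overline{N}\left(r,\frac1w\right)\ge\left(\frac34+\epsilon\right)T(r,w)+S(r,w),$$ then the coefficients $a(z)$ and $b(z)$ are both constants.
   Context: For a function $w$ meromorphic in $\mathbb{C}$, $T(r,w)$ denotes the Nevanlinna characteristic function, and the hyper-order of $w$ is $$\rho_2(w)=\limsup_{r\to\infty}\frac{\log\log T(r,w)}{\log r}.$$ $\overline{N}(r,f)$ denotes the integrated Nevanlinna counting function of the poles of $f$ ignoring multiplicities; thus $\overline{N}(r,1/w)$ counts the distinct zeros of $w$. $S(r,w)$ denotes any quantity that is $o(T(r,w))$ as $r\to\infty$ outside of an exceptional set of finite logarithmic measure; the displayed inequality is understood to hold with some such quantity $S(r,w)$. *)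

theory Defs
  imports
    "HOL-Complex_Analysis.Complex_Analysis"
    "HOL-Library.Landau_Symbols"
begin

text \<open>
  Meromorphic functions are total functions \<^typ>\<open>complex \<Rightarrow> complex\<close>, and identities between them
  (an equation, being rational, being constant) are read as holding off a closed discrete
  set, \<open>\<forall>\<^sub>\<approx>z. P z\<close>, so that the arbitrary values at poles and removable singularities play no
  role. The Nevanlinna functions below do not depend on these values either.
\<close>

definition rational_function :: "(complex \<Rightarrow> complex) \<Rightarrow> bool" where
  "rational_function f \<longleftrightarrow>
     (\<exists>p q :: complex poly. q \<noteq> 0 \<and> (\<forall>\<^sub>\<approx>z. f z = poly p z / poly q z))"

definition constant_function :: "(complex \<Rightarrow> complex) \<Rightarrow> bool" where
  "constant_function f \<longleftrightarrow> (\<exists>c. \<forall>\<^sub>\<approx>z. f z = c)"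

definition log_plus :: "real \<Rightarrow> real" where
  "log_plus x = ln (max 1 x)"

definition proximity_fun :: "real \<Rightarrow> (complex \<Rightarrow> complex) \<Rightarrow> real" where
  "proximity_fun r f =
     1 / (2 * pi) * integral {0..2*pi} (\<lambda>\<theta>. log_plus (norm (f (of_real r * cis \<theta>))))"

definition pole_count :: "real \<Rightarrow> (complex \<Rightarrow> complex) \<Rightarrow> nat" where
  "pole_count r f = (\<Sum>z\<in>{z. norm z \<le> r \<and> is_pole f z}. nat (- zorder f z))"

definition distinct_pole_count :: "real \<Rightarrow> (complex \<Rightarrow> complex) \<Rightarrow> nat" where
  "distinct_pole_count r f = card {z. norm z \<le> r \<and> is_pole f z}"

definition integrated_count :: "(real \<Rightarrow> nat) \<Rightarrow> real \<Rightarrow> real" where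
  "integrated_count n r =
     integral {0..r} (\<lambda>t. (real (n t) - real (n 0)) / t) + real (n 0) * ln r"

definition nevanlinna_N :: "real \<Rightarrow> (complex \<Rightarrow> complex) \<Rightarrow> real" where
  "nevanlinna_N r f = integrated_count (\<lambda>t. pole_count t f) r"

definition nevanlinna_Nbar :: "real \<Rightarrow> (complex \<Rightarrow> complex) \<Rightarrow> real" where
  "nevanlinna_Nbar r f = integrated_count (\<lambda>t. distinct_pole_count t f) r"

definition nevanlinna_T :: "real \<Rightarrow> (complex \<Rightarrow> complex) \<Rightarrow> real" where
  "nevanlinna_T r f = proximity_fun r f + nevanlinna_N r f"

definition hyper_order :: "(complex \<Rightarrow> complex) \<Rightarrow> ereal" where
  "hyper_order f = Limsup at_top (\<lambda>r. ereal (ln (ln (nevanlinna_T r f)) / ln r))"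

definition finite_log_measure :: "real set \<Rightarrow> bool" where
  "finite_log_measure E \<longleftrightarrow>
     E \<in> sets lebesgue \<and> (\<integral>\<^sup>+ t \<in> E \<inter> {1..}. ennreal (1 / t) \<partial>lebesgue) < \<infinity>"

text \<open>\<open>small_error S f\<close>: the function \<open>S\<close> is a quantity of the kind denoted \<open>S(r, f)\<close>.\<close>

definition small_error :: "(real \<Rightarrow> real) \<Rightarrow> (complex \<Rightarrow> complex) \<Rightarrow> bool" where
  "small_error S f \<longleftrightarrow>
     (\<exists>E. finite_log_measure E \<and>
          S \<in> o[inf at_top (principal (- E))](\<lambda>r. nevanlinna_T r f))"

end

theory Submission
  imports Defs "HOL-Real_Asymp.Real_Asymp"
begin

text \<open>
  Let \<open>z\<close> be a simple zero of \<open>w\<close>, far from the poles and zeros of the coefficients. The equation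
  determines the principal parts of \<open>w\<close> at \<open>z + k\<close> for integers \<open>k\<close>. If \<open>a\<close> and \<open>b\<close> are not both
  constant, then on at least one side of \<open>z\<close> the points at distance 1 to 4, or 1, 2, 4 and 5, are
  poles and no zero lies in between; for constant \<open>a\<close>, the residue at distance 3 cancels but the
  value there is a nonzero difference of values of \<open>b\<close>. As every pole is claimed in this way by
  at most two simple zeros, the simple zeros in \<open>\<bar>z\<bar> \<le> r\<close> are, up to \<open>O(1)\<close>, at most half as many as
  the poles in \<open>\<bar>z\<bar> \<le> r + 5\<close>. Combined with \<open>N(r, 1/w) \<le> T(r, w) + O(1)\<close> and the hypothesis on the
  distinct zeros, this gives \<open>N(r + 5, w) \<ge> (1 + \<eta>) T(r, w)\<close> up to \<open>O(log r)\<close> for most \<open>r\<close>, for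
  some \<open>\<eta> > 0\<close>.
  Iterating contradicts hyper-order less than one when \<open>w\<close> has infinitely many poles; otherwise
  \<open>T(r, w) = O(log r)\<close> along a sequence, and \<open>w\<close> is rational.
\<close>

text \<open>The threshold 3/4 comes from multiplicities. Let n1, n2, n3 count the distinct zeros,
  the zeros with multiplicity, and the poles. Every zero that is not simple has multiplicity at
  least 2, so the bound on simple zeros becomes 4 n1(r) \<le> 2 n2(r) + n3(r + 5) + O(1). Since 4 *
  3/4 - 2 = 1, the value 3/4 is exactly where T(r, w) and N(r + 5, w) balance, and \<epsilon>
  supplies the gain. A side with a run exists because the equation at a simple zero makes the
  residues at its two neighbours differ by a(z), which is nonzero far out. If both neighbours are
  poles and both points at distance 3 are regular, then a(z + 2) + a(z - 2) = a(z), which is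
  impossible far out since a(z + c) / a(z) tends to 1. The obstacle in the iteration is the
  exceptional set: a single progression r, r + 5, r + 10, ... may meet it too often. Hence ln N is
  averaged over [R, 2 R], in which good radii fill at least half of the length.\<close>

unbundle fps_syntax

section \<open>Principal parts along a chain of shifted points\<close>

text \<open>Lower bounds \<open>p\<close> and \<open>q\<close> replace exact subdegrees because the
  coefficients there may vanish. Stripping powers of the variable reduces the claim to the
  coefficients 0 and 1 of a product of power series.\<close>

lemma fls_times_nth_low:
  fixes f g :: "'a :: comm_ring_1 fls"
  assumes "\<And>k. k < p \<Longrightarrow> f $$ k = 0" "\<And>k. k < q \<Longrightarrow> g $$ k = 0"
  shows "k < p + q \<Longrightarrow> (f * g) $$ k = 0"
    and "(f * g) $$ (p + q) = f $$ p * g $$ q"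
    and "(f * g) $$ (p + q + 1) = f $$ p * g $$ (q + 1) + f $$ (p + 1) * g $$ q"
proof -
  define f' g' where "f' = fls_regpart (fls_shift p f)" and "g' = fls_regpart (fls_shift q g)"
  have f: "f = fls_shift (-p) (fps_to_fls f')"
    using assms(1) by (intro fls_eqI) (auto simp: f'_def)
  have g: "g = fls_shift (-q) (fps_to_fls g')"
    using assms(2) by (intro fls_eqI) (auto simp: g'_def)
  have fg: "f * g = fls_shift (-(p+q)) (fps_to_fls (f' * g'))"
    by (subst f, subst g) (simp add: fls_times_fps_to_fls fls_shifted_times_simps add.commute)
  show "k < p + q \<Longrightarrow> (f * g) $$ k = 0"
    by (simp add: fg)
  show "(f * g) $$ (p + q) = f $$ p * g $$ q"
    by (simp add: fg, subst f, subst g, simp)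
  show "(f * g) $$ (p + q + 1) = f $$ p * g $$ (q + 1) + f $$ (p + 1) * g $$ q"
    by (simp add: fg fps_mult_nth nat_add_distrib, simp add: f'_def g'_def add.commute)
qed

text \<open>Compare coefficients in \<open>G * F = fls_deriv F\<close>. Index n - 1 gives G(-1) F(n)
  = n F(n), and index n gives G(-1) F(n + 1) + G(0) F(n) = (n + 1) F(n + 1).\<close>

lemma fls_logderiv_nth:
  fixes F :: "'a :: field_char_0 fls"
  assumes "F \<noteq> 0"
  defines "n \<equiv> fls_subdegree F" and "G \<equiv> fls_deriv F / F"
  shows "k < -1 \<Longrightarrow> G $$ k = 0"
    and "G $$ (-1) = of_int n"
    and "G $$ 0 * F $$ n = F $$ (n + 1)"
proof -
  have GF: "G * F = fls_deriv F" using assms by simp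
  have Fn: "F $$ n \<noteq> 0" using assms by simp
  have F0: "\<And>k. k < n \<Longrightarrow> F $$ k = 0" by (simp add: n_def)
  have G0: "G $$ k = 0" if "k < -1" for k
  proof (cases "G = 0")
    case False
    then have "fls_deriv F \<noteq> 0" using GF assms(1) by auto
    have sd: "fls_subdegree (fls_deriv F) = fls_subdegree G + n"
      using False assms(1) by (subst GF[symmetric]) (simp add: n_def)
    have "n - 1 \<le> fls_subdegree (fls_deriv F)"
      using \<open>fls_deriv F \<noteq> 0\<close> by (intro fls_subdegree_geI) (auto simp: n_def)
    with sd that show ?thesis by simp
  qed auto
  then show "k < -1 \<Longrightarrow> G $$ k = 0" .
  have "fls_deriv F $$ (-1 + n) = G $$ (-1) * F $$ n"
    unfolding GF[symmetric] by (rule fls_times_nth_low) (use G0 F0 in auto)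
  then show G1: "G $$ (-1) = of_int n" using Fn by simp
  have "fls_deriv F $$ (-1 + n + 1) = G $$ (-1) * F $$ (n + 1) + G $$ (-1 + 1) * F $$ n"
    unfolding GF[symmetric] by (rule fls_times_nth_low) (use G0 F0 in auto)
  then show "G $$ 0 * F $$ n = F $$ (n + 1)" using G1 by (simp add: algebra_simps)
qed

lemma fls_subdegree_neg_if_nth: "F $$ k \<noteq> 0 \<Longrightarrow> k < 0 \<Longrightarrow> fls_subdegree F < 0"
  by (meson fls_subdegree_leI order.strict_trans1)

text \<open>After division by \<open>x\<close> the real part is m + Re (y / x) n < 0. This excludes
  cancellation between the residues produced by two poles.\<close>

lemma add_scaled_neg_neq_0:
  fixes m n :: int and x y :: complex
  assumes "m < 0" "n < 0" "Re (y / x) > 0" "x \<noteq> 0"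
  shows "x * of_int m + y * of_int n \<noteq> 0"
proof
  assume "x * of_int m + y * of_int n = 0"
  then have "of_int m + (y / x) * of_int n = 0" using assms by (simp add: field_simps)
  then have "Re (of_int m + (y / x) * of_int n) = 0" by (simp only: zero_complex.sel)
  then have "of_int m + Re (y / x) * of_int n = 0" by (simp del: times_divide_eq_left)
  moreover have "Re (y / x) * of_int n < 0" using assms by (simp add: mult_pos_neg)
  ultimately show False using assms(1) by (smt (verit) of_int_less_0_iff)
qed

text \<open>\<open>m k\<close> is meant as the order of \<open>w\<close> at distance k to one side
  of a simple zero. In the second alternative \<open>m 3 = 0\<close> ensures that no zero separates
  the simple zero from the poles at 4 and 5.\<close>

definition pole_run :: "(int \<Rightarrow> int) \<Rightarrow> bool" where
  "pole_run m \<longleftrightarrow> (\<forall>k\<in>{1,2,3,4}. m k < 0) \<or> (\<forall>k\<in>{1,2,4,5}. m k < 0) \<and> m 3 = 0"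

text \<open>\<open>F k\<close>, \<open>A k\<close>, \<open>B k\<close> stand for the expansions of
  w, a, b at the point z + k, which turns the local analysis into comparison of coefficients. The
  range 5 is the length of the longest run.\<close>

locale delay_chain =
  fixes F A B :: "int \<Rightarrow> complex fls" and m :: "int \<Rightarrow> int" and a b :: "int \<Rightarrow> complex"
  assumes F_nz: "F k \<noteq> 0"
    and A_reg: "\<bar>k\<bar> \<le> 5 \<Longrightarrow> j < 0 \<Longrightarrow> A k $$ j = 0"
    and B_reg: "\<bar>k\<bar> \<le> 5 \<Longrightarrow> j < 0 \<Longrightarrow> B k $$ j = 0"
    and chain: "\<bar>k\<bar> \<le> 5 \<Longrightarrow> F (k + 1) - F (k - 1) + A k * (fls_deriv (F k) / F k) = B k"
    and A_nz: "\<bar>k\<bar> \<le> 5 \<Longrightarrow> A k $$ 0 \<noteq> 0"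
  defines "m \<equiv> (\<lambda>k. fls_subdegree (F k))" and "a \<equiv> (\<lambda>k. A k $$ 0)" and "b \<equiv> (\<lambda>k. B k $$ 0)"
begin

lemma a_nz: "\<bar>k\<bar> \<le> 5 \<Longrightarrow> a k \<noteq> 0"
  using A_nz by (simp add: a_def)

text \<open>The logarithmic derivative has at most a simple pole, its residue is the order
  \<open>m k\<close>, and \<open>A k\<close> is regular. Only the residue is therefore changed by a
  step of length 2; polar coefficients of higher order are copied.\<close>

lemma residue_step:
  assumes "\<bar>k\<bar> \<le> 5"
  shows "F (k + 1) $$ -1 = F (k - 1) $$ -1 - a k * of_int (m k)"
proof -
  have "F (k + 1) $$ -1 - F (k - 1) $$ -1 + (A k * (fls_deriv (F k) / F k)) $$ (0 + -1) = B k $$ -1"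
    using chain[OF assms] by (simp flip: fls_plus_nth fls_minus_nth)
  also have "(A k * (fls_deriv (F k) / F k)) $$ (0 + -1) = A k $$ 0 * (fls_deriv (F k) / F k) $$ -1"
    by (rule fls_times_nth_low) (use A_reg assms fls_logderiv_nth(1)[OF F_nz[of k]] in auto)
  finally show ?thesis
    using assms B_reg fls_logderiv_nth(2)[OF F_nz] by (simp add: a_def m_def algebra_simps)
qed

lemma principal_step:
  assumes "\<bar>k\<bar> \<le> 5" "j < -1"
  shows "F (k + 1) $$ j = F (k - 1) $$ j"
proof -
  have "F (k + 1) $$ j - F (k - 1) $$ j + (A k * (fls_deriv (F k) / F k)) $$ j = B k $$ j"
    using chain[OF assms(1)] by (simp flip: fls_plus_nth fls_minus_nth)
  moreover have "(A k * (fls_deriv (F k) / F k)) $$ j = 0"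
    by (rule fls_times_nth_low[of 0 _ "-1"]) (use A_reg assms fls_logderiv_nth(1)[OF F_nz[of k]] in auto)
  ultimately show ?thesis using assms B_reg by simp
qed

text \<open>The residue at 2 is - a 1 * m 1, because 0 is a zero, and the residue at 4 is - (a 1 * m
  1 + a 3 * m 3). The second cannot vanish: both orders are negative and \<open>a 1\<close>,
  \<open>a 3\<close> enclose less than a right angle.\<close>

lemma pole_run_if_poles_1_3:
  assumes "m 0 = 1" "m 1 < 0" "m 3 < 0" "Re (a 3 / a 1) > 0"
  shows "pole_run m"
proof -
  have 2: "F 2 $$ -1 = - a 1 * of_int (m 1)"
    using residue_step[of 1] assms(1) by (simp add: m_def)
  then have "m 2 < 0"
    using assms(2) a_nz[of 1] unfolding m_def
    by (intro fls_subdegree_neg_if_nth[where k = "-1"]) auto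
  have "F 4 $$ -1 = - (a 1 * of_int (m 1) + a 3 * of_int (m 3))"
    using residue_step[of 3] 2 by simp
  moreover have "a 1 * of_int (m 1) + a 3 * of_int (m 3) \<noteq> 0"
    by (rule add_scaled_neg_neq_0) (use assms a_nz in auto)
  ultimately have "F 4 $$ -1 \<noteq> 0" by (simp only: neg_equal_0_iff_equal not_False_eq_True)
  then have "m 4 < 0" unfolding m_def
    by (intro fls_subdegree_neg_if_nth[where k = "-1"]) auto
  with \<open>m 2 < 0\<close> show ?thesis using assms by (simp add: pole_run_def)
qed

text \<open>At a simple pole the constant coefficient of the logarithmic derivative is the quotient
  of the coefficients 0 and -1. \<open>A k\<close> is taken constant because its linear coefficient
  would otherwise enter as well, multiplied by the residue -1.\<close>

lemma F_nth_above_simple_pole: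
  assumes "m k = -1" "A k = fls_const c" "\<bar>k\<bar> \<le> 5"
  shows "F (k + 1) $$ 0 = F (k - 1) $$ 0 - c * (F k $$ 0 / F k $$ -1) + b k"
proof -
  have "(fls_deriv (F k) / F k) $$ 0 * F k $$ -1 = F k $$ 0"
    using fls_logderiv_nth(3)[OF F_nz[of k]] assms(1) by (simp add: m_def)
  moreover have "F k $$ -1 \<noteq> 0" using assms(1) F_nz[of k] unfolding m_def
    by (metis nth_fls_subdegree_zero_iff)
  ultimately have "(fls_deriv (F k) / F k) $$ 0 = F k $$ 0 / F k $$ -1" by (simp add: field_simps)
  moreover have "F (k + 1) $$ 0 - F (k - 1) $$ 0 + (A k * (fls_deriv (F k) / F k)) $$ 0 = B k $$ 0"
    using chain[OF assms(3)] by (simp flip: fls_plus_nth fls_minus_nth)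
  moreover have "(A k * (fls_deriv (F k) / F k)) $$ 0 = c * (fls_deriv (F k) / F k) $$ 0"
    unfolding assms(2) by (simp only: fls_mult_const_nth)
  ultimately show ?thesis by (simp add: b_def algebra_simps)
qed

text \<open>Without a pole at -1 the residues at 1, 2, 3 are - a 0, a 1 and a 2 - a 0. If the last
  one vanishes, the constant coefficients yield the value b 2 - b 1 at 3; as it is nonzero, 3 is not
  a zero.\<close>

lemma pole_run_if_regular_left:
  assumes "m 0 = 1" "m (-1) \<ge> 0" "Re (a 3 / a 1) > 0"
    and alt: "a 2 \<noteq> a 0 \<or> b 2 \<noteq> b 1 \<and> (\<forall>k. \<bar>k\<bar> \<le> 5 \<longrightarrow> A k = fls_const c)"
  shows "pole_run m"
proof -
  have r0: "F 0 $$ j = 0" if "j < 1" for j using assms(1) that by (simp add: m_def)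
  have rm1: "F (-1) $$ j = 0" if "j < 0" for j using assms(2) that by (simp add: m_def)
  have 1: "F 1 $$ -1 = - a 0" using residue_step[of 0] rm1 assms(1) by simp
  have pp1: "F 1 $$ j = 0" if "j < -1" for j using principal_step[of 0 j] rm1 that by simp
  have m1: "m 1 = -1"
    unfolding m_def by (rule fls_subdegree_eqI) (use 1 pp1 a_nz[of 0] in auto)
  have 2: "F 2 $$ -1 = a 1" using residue_step[of 1] r0 m1 by simp
  have pp2: "F 2 $$ j = 0" if "j < -1" for j using principal_step[of 1 j] r0 that by simp
  have m2: "m 2 = -1"
    unfolding m_def by (rule fls_subdegree_eqI) (use 2 pp2 a_nz[of 1] in auto)
  have 3: "F 3 $$ -1 = a 2 - a 0" using residue_step[of 2] 1 m2 by simp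
  have pp3: "F 3 $$ j = 0" if "j < -1" for j using principal_step[of 2 j] pp1 that by simp
  show ?thesis
  proof (cases "a 2 = a 0")
    case False
    then have "m 3 < 0" unfolding m_def
      by (intro fls_subdegree_neg_if_nth[where k = "-1"]) (use 3 in auto)
    then show ?thesis using pole_run_if_poles_1_3 assms m1 by simp
  next
    case True
    with alt have b: "b 2 \<noteq> b 1" and A: "\<And>k. \<bar>k\<bar> \<le> 5 \<Longrightarrow> A k = fls_const c" by auto
    have a: "a k = c" if "\<bar>k\<bar> \<le> 5" for k using A[OF that] by (simp add: a_def)
    have c: "c \<noteq> 0" using a[of 0] a_nz[of 0] by simp
    have "F 2 $$ 0 = F 1 $$ 0 + b 1"
      using F_nth_above_simple_pole[OF m1 A] 1 r0 c a by simp
    moreover have "F 3 $$ 0 = F 1 $$ 0 - F 2 $$ 0 + b 2"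
      using F_nth_above_simple_pole[OF m2 A] 2 c a by simp
    ultimately have 30: "F 3 $$ 0 = b 2 - b 1" by simp
    have nn3: "F 3 $$ j = 0" if "j < 0" for j
      using 3 pp3[of j] True that by (cases "j = -1") auto
    have m3: "m 3 = 0" unfolding m_def
      by (rule fls_subdegree_eqI) (use 30 b nn3 in auto)
    \<comment> \<open>Since \<open>m 3 = 0\<close>, the residue at 2 is passed on to 4 unchanged.
      The pole at 4 then creates one at 5, where the residue inherited from 3 is zero.\<close>
    have m4: "m 4 < 0" unfolding m_def
      by (intro fls_subdegree_neg_if_nth[where k = "-1"]) (use residue_step[of 3] m3 2 a_nz[of 1] in auto)
    have m5: "m 5 < 0" unfolding m_def
      by (intro fls_subdegree_neg_if_nth[where k = "-1"])
        (use residue_step[of 4] m4 3 True a_nz[of 4] in auto)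
    show ?thesis using m1 m2 m3 m4 m5 by (simp add: pole_run_def)
  qed
qed

text \<open>The points 2 and -2 are simple poles, so regularity at 3 and -3 forces the residues - a
  2 at 1 and a (-2) at -1. The simple zero at 0 makes these two differ by a 0.\<close>

lemma regular_at_distance_3:
  assumes "m 0 = 1" "m 1 < 0" "m (-1) < 0" "m 3 \<ge> 0" "m (-3) \<ge> 0"
  shows "a 2 + a (-2) = a 0"
proof -
  have r0: "F 0 $$ j = 0" if "j < 1" for j using assms(1) that by (simp add: m_def)
  have m2: "m 2 = -1" unfolding m_def
    by (rule fls_subdegree_eqI)
      (use residue_step[of 1] principal_step[of 1] r0 assms(2) a_nz[of 1] in auto)
  have mm2: "m (-2) = -1" unfolding m_def
    by (rule fls_subdegree_eqI)
      (use residue_step[of "-1"] principal_step[of "-1"] r0 assms(3) a_nz[of "-1"] in auto)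
  have "F 3 $$ -1 = 0" "F (-3) $$ -1 = 0" using assms by (auto simp: m_def)
  then have "F 1 $$ -1 = - a 2" "F (-1) $$ -1 = a (-2)"
    using residue_step[of 2] residue_step[of "-2"] m2 mm2 by (auto simp: add_eq_0_iff)
  then show ?thesis using residue_step[of 0] assms(1) by (simp add: algebra_simps)
qed

end

section \<open>Counting functions\<close>

text \<open>The weight is left open so that the same lemmas serve multiplicities of zeros,
  multiplicities of poles, and the indicator of the zeros.\<close>

definition disc_count :: "(complex \<Rightarrow> nat) \<Rightarrow> real \<Rightarrow> nat" where
  "disc_count \<mu> t = (\<Sum>s\<in>{s. norm s \<le> t \<and> \<mu> s \<noteq> 0}. \<mu> s)"

definition locally_finite_support :: "(complex \<Rightarrow> nat) \<Rightarrow> bool" where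
  "locally_finite_support \<mu> \<longleftrightarrow> (\<forall>r. finite {s. norm s \<le> r \<and> \<mu> s \<noteq> 0})"

section \<open>Simple zeros and the poles they claim\<close>

lemma pole_runE:
  assumes "pole_run m"
  obtains K where "card K = 4" "K \<subseteq> {1..5}" "\<And>k. k \<in> K \<Longrightarrow> m k < 0"
    "\<And>k j. k \<in> K \<Longrightarrow> 1 \<le> j \<Longrightarrow> j \<le> k \<Longrightarrow> m j \<le> 0"
proof -
  have up: "j \<in> {1,2,3,4,5}" if "1 \<le> j" "j \<le> 5" for j :: int using that by auto
  from assms consider "\<forall>k\<in>{1,2,3,4}. m k < 0" | "\<forall>k\<in>{1,2,4,5}. m k < 0" "m 3 = 0"
    unfolding pole_run_def by blast
  then show thesis
  proof cases
    case 1
    show thesis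
    proof (rule that[of "{1,2,3,4}"])
      fix k j :: int assume "k \<in> {1,2,3,4}" "1 \<le> j" "j \<le> k"
      then have "j \<in> {1,2,3,4}" by auto
      then show "m j \<le> 0" using 1 by force
    qed (use 1 in auto)
  next
    case 2
    show thesis
    proof (rule that[of "{1,2,4,5}"])
      fix k j :: int assume "k \<in> {1,2,4,5}" "1 \<le> j" "j \<le> k"
      then have "j \<in> {1,2,3,4,5}" by auto
      then show "m j \<le> 0" using 2 by force
    qed (use 2 in auto)
  qed
qed

text \<open>Every pole is claimed by at most two simple zeros, the nearest zero on either side, while
  a simple zero far from the origin claims four poles.\<close>

lemma simple_zeros_le_poles:
  fixes m :: "complex \<Rightarrow> int"
  assumes fin: "\<And>r. finite {z. norm z \<le> r \<and> m z \<noteq> 0}"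
    and run: "\<And>z. R \<le> norm z \<Longrightarrow> m z = 1 \<Longrightarrow>
      pole_run (\<lambda>k. m (z + of_int k)) \<or> pole_run (\<lambda>k. m (z - of_int k))"
  shows "2 * card {z. norm z \<le> r \<and> m z = 1} \<le>
    card {z. norm z \<le> r + 5 \<and> m z < 0} + 2 * card {z. norm z \<le> R \<and> m z = 1}"
proof -
  define D where "D = {z. norm z \<le> r \<and> R \<le> norm z \<and> m z = 1}"
  define P where "P = {z. norm z \<le> r + 5 \<and> m z < 0}"
  have finP: "finite P" unfolding P_def by (rule finite_subset[OF _ fin[of "r + 5"]]) auto
  have finD: "finite D" unfolding D_def by (rule finite_subset[OF _ fin[of r]]) auto
  \<comment> \<open>\<open>sg\<close> is the side of the run and \<open>K\<close> the set of
    distances of its four poles; the last clause says that no zero precedes a claimed pole.\<close>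
  define Q where "Q = (\<lambda>z sg K. (sg = 1 \<or> sg = -1) \<and> card K = 4 \<and> K \<subseteq> {1..5} \<and>
      (\<forall>k\<in>K. m (z + of_int (sg * k)) < 0) \<and>
      (\<forall>k\<in>K. \<forall>j. 1 \<le> j \<longrightarrow> j \<le> k \<longrightarrow> m (z + of_int (sg * j)) \<le> 0))"
  have "\<exists>p. Q z (fst p) (snd p)" if "z \<in> D" for z
  proof -
    from that have "pole_run (\<lambda>k. m (z + of_int k)) \<or> pole_run (\<lambda>k. m (z - of_int k))"
      using run unfolding D_def by blast
    then obtain sg :: int where sg: "sg = 1 \<or> sg = -1" "pole_run (\<lambda>k. m (z + of_int (sg * k)))"
    proof
      assume "pole_run (\<lambda>k. m (z + of_int k))"
      then show thesis using that[of 1] by simp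
    next
      assume "pole_run (\<lambda>k. m (z - of_int k))"
      then show thesis using that[of "-1"] by simp
    qed
    from sg(2) show ?thesis
    proof (rule pole_runE)
      fix K
      assume "card K = 4" "K \<subseteq> {1..5}" "\<And>k. k \<in> K \<Longrightarrow> m (z + of_int (sg * k)) < 0"
        "\<And>k j. k \<in> K \<Longrightarrow> 1 \<le> j \<Longrightarrow> j \<le> k \<Longrightarrow> m (z + of_int (sg * j)) \<le> 0"
      then have "Q z sg K" using sg(1) unfolding Q_def by blast
      then show ?thesis by (intro exI[of _ "(sg, K)"]) simp
    qed
  qed
  then obtain p where p: "\<And>z. z \<in> D \<Longrightarrow> Q z (fst (p z)) (snd (p z))" by metis
  define sg K where "sg = fst \<circ> p" and "K = snd \<circ> p"
  have sgK: "\<And>z. z \<in> D \<Longrightarrow> sg z = 1 \<or> sg z = -1"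
      "\<And>z. z \<in> D \<Longrightarrow> card (K z) = 4" "\<And>z. z \<in> D \<Longrightarrow> K z \<subseteq> {1..5}"
      "\<And>z k. z \<in> D \<Longrightarrow> k \<in> K z \<Longrightarrow> m (z + of_int (sg z * k)) < 0"
      "\<And>z k j. z \<in> D \<Longrightarrow> k \<in> K z \<Longrightarrow> 1 \<le> j \<Longrightarrow> j \<le> k \<Longrightarrow> m (z + of_int (sg z * j)) \<le> 0"
    using p unfolding Q_def sg_def K_def o_def by blast+
  \<comment> \<open>A claim is recorded as the pole together with the side, so that the two sides
    account for the factor 2 between claims and poles.\<close>
  define \<phi> where "\<phi> = (\<lambda>(z, k). (z + of_int (sg z * k), sg z))"
  \<comment> \<open>Here \<open>z\<close> would lie at distance \<open>k' - k\<close> from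
    \<open>z'\<close>, on the way to a pole claimed by \<open>z'\<close>, where no zero is
    allowed.\<close>
  have neq: False if "z \<in> D" "z' \<in> D" "k \<in> K z" "k' \<in> K z'" "sg z = sg z'" "k < k'"
    "z + of_int (sg z * k) = z' + of_int (sg z' * k')" for z z' k k'
  proof -
    have "z = z' + of_int (sg z' * (k' - k))" using that(5,7) by (simp add: algebra_simps)
    moreover have "m (z' + of_int (sg z' * (k' - k))) \<le> 0"
      by (rule sgK(5)[OF that(2,4)]) (use that sgK(3)[OF that(1)] in auto)
    ultimately show False using that(1) unfolding D_def by simp
  qed
  have "inj_on \<phi> (Sigma D K)"
  proof (rule inj_onI, clarify)
    fix z k z' k' assume h: "z \<in> D" "k \<in> K z" "z' \<in> D" "k' \<in> K z'" "\<phi> (z, k) = \<phi> (z', k')"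
    then have e: "z + of_int (sg z * k) = z' + of_int (sg z' * k')" "sg z = sg z'"
      by (auto simp: \<phi>_def)
    have "k = k'"
      using neq[OF h(1,3,2,4)] neq[OF h(3,1,4,2)] e by (metis linorder_neqE_linordered_idom)
    then show "z = z' \<and> k = k'" using e by simp
  qed
  then have "card (Sigma D K) = card (\<phi> ` Sigma D K)" by (simp add: card_image)
  also have "\<phi> ` Sigma D K \<subseteq> P \<times> {1, -1}"
  proof (clarify)
    fix z k p t assume h: "z \<in> D" "k \<in> K z" "(p, t) = \<phi> (z, k)"
    have "\<bar>sg z * k\<bar> \<le> 5" using sgK(1,3)[OF h(1)] h(2) by auto
    then have "norm (of_int (sg z * k) :: complex) \<le> 5" by (simp only: norm_of_int)
    then have "norm (z + of_int (sg z * k)) \<le> r + 5"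
      using h(1) norm_triangle_ineq[of z "of_int (sg z * k)"] unfolding D_def by simp
    then have "p \<in> P" using h sgK(4)[OF h(1,2)] by (simp add: \<phi>_def P_def)
    then show "p \<in> P \<and> t \<in> {1, -1}" using h sgK(1)[OF h(1)] by (auto simp: \<phi>_def)
  qed
  then have "card (\<phi> ` Sigma D K) \<le> card (P \<times> {1, -1 :: int})"
    by (intro card_mono finite_cartesian_product finP) auto
  also have "\<dots> = 2 * card P" by (simp add: card_cartesian_product)
  finally have "card (Sigma D K) \<le> 2 * card P" .
  moreover have "card (Sigma D K) = 4 * card D"
  proof -
    have "finite (K z)" if "z \<in> D" for z using sgK(3)[OF that] finite_subset by blast
    then have "card (Sigma D K) = (\<Sum>z\<in>D. card (K z))" using finD by (intro card_SigmaI) auto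
    then show ?thesis using sgK(2) by simp
  qed
  ultimately have "2 * card D \<le> card P" by simp
  moreover have "card {z. norm z \<le> r \<and> m z = 1} \<le> card (D \<union> {z. norm z \<le> R \<and> m z = 1})"
    by (intro card_mono finite_UnI finD finite_subset[OF _ fin[of R]]) (auto simp: D_def)
  moreover have "card (D \<union> {z. norm z \<le> R \<and> m z = 1}) \<le> card D + card {z. norm z \<le> R \<and> m z = 1}"
    by (rule card_Un_le)
  ultimately show ?thesis unfolding P_def by linarith
qed

lemma disc_count_inequality:
  fixes m :: "complex \<Rightarrow> int"
  assumes fin: "\<And>r. finite {z. norm z \<le> r \<and> m z \<noteq> 0}"
    and run: "\<And>z. R \<le> norm z \<Longrightarrow> m z = 1 \<Longrightarrow>
      pole_run (\<lambda>k. m (z + of_int k)) \<or> pole_run (\<lambda>k. m (z - of_int k))"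
  obtains C where "\<And>r. 4 * disc_count (\<lambda>z. if m z > 0 then 1 else 0) r \<le>
    2 * disc_count (\<lambda>z. nat (m z)) r + disc_count (\<lambda>z. nat (- m z)) (r + 5) + C"
proof
  fix r
  let ?Z = "{z. norm z \<le> r \<and> m z > 0}"
  have finZ: "finite ?Z" by (rule finite_subset[OF _ fin[of r]]) auto
  have finP: "finite {z. norm z \<le> r + 5 \<and> m z < 0}" by (rule finite_subset[OF _ fin[of "r + 5"]]) auto
  have 1: "disc_count (\<lambda>z. if m z > 0 then 1 else 0) r = card ?Z"
  proof -
    have "{s. norm s \<le> r \<and> (if m s > 0 then 1 else (0::nat)) \<noteq> 0} = ?Z" by auto
    then show ?thesis by (simp add: disc_count_def)
  qed
  have 2: "disc_count (\<lambda>z. nat (m z)) r = (\<Sum>z\<in>?Z. nat (m z))"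
    unfolding disc_count_def by (rule sum.cong) auto
  have "card {z. norm z \<le> r + 5 \<and> m z < 0} = (\<Sum>z\<in>{z. norm z \<le> r + 5 \<and> m z < 0}. 1)" by simp
  also have "\<dots> \<le> (\<Sum>z\<in>{z. norm z \<le> r + 5 \<and> m z < 0}. nat (- m z))" by (intro sum_mono) auto
  also have "\<dots> = disc_count (\<lambda>z. nat (- m z)) (r + 5)"
    unfolding disc_count_def by (rule sum.cong) auto
  finally have 3: "card {z. norm z \<le> r + 5 \<and> m z < 0} \<le> disc_count (\<lambda>z. nat (- m z)) (r + 5)" .
  \<comment> \<open>A zero is simple or has multiplicity at least 2. Doubling this estimate leaves 2
    times the number of simple zeros, which is what the claims bound.\<close>
  have "2 * card ?Z = (\<Sum>z\<in>?Z. 2)" by simp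
  also have "\<dots> \<le> (\<Sum>z\<in>?Z. nat (m z) + (if m z = 1 then 1 else 0))" by (intro sum_mono) auto
  also have "\<dots> = (\<Sum>z\<in>?Z. nat (m z)) + (\<Sum>z\<in>?Z. if m z = 1 then 1 else 0)" by (rule sum.distrib)
  also have "(\<Sum>z\<in>?Z. if m z = 1 then 1 else 0) = card {z\<in>?Z. m z = 1}"
    using finZ by (simp add: sum.If_cases Int_def)
  also have "{z\<in>?Z. m z = 1} = {z. norm z \<le> r \<and> m z = 1}" by auto
  finally have "4 * card ?Z \<le> 2 * (\<Sum>z\<in>?Z. nat (m z)) + 2 * card {z. norm z \<le> r \<and> m z = 1}" by simp
  then show "4 * disc_count (\<lambda>z. if m z > 0 then 1 else 0) r \<le>
    2 * disc_count (\<lambda>z. nat (m z)) r + disc_count (\<lambda>z. nat (- m z)) (r + 5)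
      + 2 * card {z. norm z \<le> R \<and> m z = 1}"
    using simple_zeros_le_poles[OF fin run, of R r] 1 2 3 by simp
qed

section \<open>Integrated counting functions\<close>

lemma locally_finite_supportD:
  "locally_finite_support \<mu> \<Longrightarrow> finite {s. norm s \<le> r \<and> \<mu> s \<noteq> 0}"
  by (simp add: locally_finite_support_def)

lemma disc_count_mono:
  assumes "locally_finite_support \<mu>" "r \<le> t"
  shows "disc_count \<mu> r \<le> disc_count \<mu> t"
  unfolding disc_count_def using assms
  by (intro sum_mono2 locally_finite_supportD) auto

lemma disc_count_0: "disc_count \<mu> 0 = \<mu> 0"
proof -
  have "{s. norm s \<le> 0 \<and> \<mu> s \<noteq> 0} = (if \<mu> 0 = 0 then {} else {0})" by auto
  then show ?thesis by (simp add: disc_count_def)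
qed

lemma has_integral_inverse_ln:
  fixes a r :: real
  assumes "0 < a" "a \<le> r"
  shows "((\<lambda>t. 1 / t) has_integral (ln r - ln a)) {a..r}"
proof -
  have "(ln has_vector_derivative 1 / x) (at x within {a..r})" if "x \<in> {a..r}" for x
    using that assms
    by (auto intro!: derivative_eq_intros simp flip: has_real_derivative_iff_has_vector_derivative)
  then show ?thesis
    using fundamental_theorem_of_calculus[of a r ln "\<lambda>t. 1 / t"] assms by simp
qed

lemma has_integral_indicator_inverse:
  fixes a r :: real
  assumes "0 < a" "a \<le> r"
  shows "((\<lambda>t. (if a \<le> t then 1 else 0) / t) has_integral ln (r / a)) {0..r}"
proof -
  have "((\<lambda>t. 1 / t) has_integral (ln r - ln a)) {a..r}"
    by (rule has_integral_inverse_ln) (use assms in auto)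
  then have "((\<lambda>t. if t \<in> {a..r} then 1 / t else 0) has_integral (ln r - ln a)) {0..r}"
    using assms by (subst has_integral_restrict) (auto simp: subset_iff)
  then have "((\<lambda>t. (if a \<le> t then 1 else 0) / t) has_integral (ln r - ln a)) {0..r}"
    by (rule has_integral_eq[rotated]) auto
  then show ?thesis using assms by (simp add: ln_div)
qed

text \<open>The count is a finite sum of jump functions, one for each point s other than 0, and the
  jump at norm s contributes ln (r / norm s) to the integral.\<close>

lemma disc_count_has_integral:
  assumes "locally_finite_support \<mu>" "0 < r"
  shows "((\<lambda>t. (real (disc_count \<mu> t) - real (disc_count \<mu> 0)) / t) has_integral
    (\<Sum>s\<in>{s. norm s \<le> r \<and> \<mu> s \<noteq> 0} - {0}. real (\<mu> s) * ln (r / norm s))) {0..r}"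
proof -
  let ?S = "{s. norm s \<le> r \<and> \<mu> s \<noteq> 0}"
  have fin: "finite ?S" using assms(1) by (rule locally_finite_supportD)
  have "((\<lambda>t. \<Sum>s\<in>?S - {0}. real (\<mu> s) * ((if norm s \<le> t then 1 else 0) / t)) has_integral
    (\<Sum>s\<in>?S - {0}. real (\<mu> s) * ln (r / norm s))) {0..r}"
    by (intro has_integral_sum has_integral_mult_right has_integral_indicator_inverse) (use fin in auto)
  then show ?thesis
  proof (rule has_integral_eq[rotated])
    fix t assume t: "t \<in> {0..r}"
    have "{s. norm s \<le> t \<and> \<mu> s \<noteq> 0} - {0} = {s \<in> ?S - {0}. norm s \<le> t}" using t by auto
    moreover have "disc_count \<mu> t = \<mu> 0 + (\<Sum>s\<in>{s. norm s \<le> t \<and> \<mu> s \<noteq> 0} - {0}. \<mu> s)"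
    proof (cases "\<mu> 0 = 0")
      case True
      then have "{s. norm s \<le> t \<and> \<mu> s \<noteq> 0} - {0} = {s. norm s \<le> t \<and> \<mu> s \<noteq> 0}" by auto
      then show ?thesis using True by (simp add: disc_count_def)
    next
      case False
      then show ?thesis using locally_finite_supportD[OF assms(1), of t] t
        by (simp add: disc_count_def sum.remove[of _ 0])
    qed
    ultimately have "real (disc_count \<mu> t) - real (disc_count \<mu> 0) = (\<Sum>s\<in>{s \<in> ?S - {0}. norm s \<le> t}. real (\<mu> s))"
      by (simp add: disc_count_0)
    also have "\<dots> = (\<Sum>s\<in>?S - {0}. if norm s \<le> t then real (\<mu> s) else 0)"
      using fin by (simp only: sum.inter_filter finite_Diff)
    also have "\<dots> / t = (\<Sum>s\<in>?S - {0}. real (\<mu> s) * ((if norm s \<le> t then 1 else 0) / t))"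
      by (subst sum_divide_distrib, rule sum.cong) auto
    finally show "(\<Sum>s\<in>?S - {0}. real (\<mu> s) * ((if norm s \<le> t then 1 else 0) / t)) =
      (real (disc_count \<mu> t) - real (disc_count \<mu> 0)) / t" by simp
  qed
qed

lemma integrated_count_eq_sum:
  assumes "locally_finite_support \<mu>" "0 < r"
  shows "integrated_count (disc_count \<mu>) r =
    (\<Sum>s\<in>{s. norm s \<le> r \<and> \<mu> s \<noteq> 0} - {0}. real (\<mu> s) * ln (r / norm s)) + real (\<mu> 0) * ln r"
  unfolding integrated_count_def using integral_unique[OF disc_count_has_integral[OF assms]]
  by (simp add: disc_count_0)

text \<open>On [a, r] the subtracted n(0) / t integrates to n(0) (ln r - ln a), which is what the
  summand n(0) ln r restores.\<close>

lemma integrated_count_diff_has_integral: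
  assumes "locally_finite_support \<mu>" "0 < a" "a \<le> r"
  shows "((\<lambda>t. real (disc_count \<mu> t) / t) has_integral
    (integrated_count (disc_count \<mu>) r - integrated_count (disc_count \<mu>) a)) {a..r}"
proof -
  let ?f = "\<lambda>t. (real (disc_count \<mu> t) - real (disc_count \<mu> 0)) / t"
  have int: "?f integrable_on {0..r}"
    using disc_count_has_integral[of \<mu> r] assms by (auto simp: integrable_on_def)
  then have int': "?f integrable_on {a..r}"
    by (rule integrable_on_subinterval) (use assms in auto)
  have "integral {0..a} ?f + integral {a..r} ?f = integral {0..r} ?f"
    by (rule Henstock_Kurzweil_Integration.integral_combine) (use assms int in auto)
  then have "(?f has_integral (integral {0..r} ?f - integral {0..a} ?f)) {a..r}"
    using int' by (simp add: has_integral_iff algebra_simps)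
  moreover have "((\<lambda>t. 1 / t) has_integral (ln r - ln a)) {a..r}"
    by (rule has_integral_inverse_ln) (use assms in auto)
  ultimately have "((\<lambda>t. ?f t + real (disc_count \<mu> 0) * (1 / t)) has_integral
     (integral {0..r} ?f - integral {0..a} ?f + real (disc_count \<mu> 0) * (ln r - ln a))) {a..r}"
    by (intro has_integral_add has_integral_mult_right)
  moreover have "(\<lambda>t. ?f t + real (disc_count \<mu> 0) * (1 / t)) = (\<lambda>t. real (disc_count \<mu> t) / t)"
    by (simp add: fun_eq_iff diff_divide_distrib)
  ultimately show ?thesis by (simp add: integrated_count_def algebra_simps)
qed

lemma integrated_count_ge:
  assumes "locally_finite_support \<mu>" "0 < a" "a \<le> r"
  shows "integrated_count (disc_count \<mu>) r \<ge>
    integrated_count (disc_count \<mu>) a + real (disc_count \<mu> a) * (ln r - ln a)"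
proof -
  have "((\<lambda>t. 1 / t) has_integral (ln r - ln a)) {a..r}"
    by (rule has_integral_inverse_ln) (use assms in auto)
  then have "((\<lambda>t. real (disc_count \<mu> a) * (1 / t)) has_integral real (disc_count \<mu> a) * (ln r - ln a)) {a..r}"
    by (rule has_integral_mult_right)
  then have "real (disc_count \<mu> a) * (ln r - ln a) \<le>
      integrated_count (disc_count \<mu>) r - integrated_count (disc_count \<mu>) a"
    by (rule has_integral_le[OF _ integrated_count_diff_has_integral[OF assms]])
      (use assms disc_count_mono[OF assms(1)] in \<open>auto intro!: divide_right_mono\<close>)
  then show ?thesis by simp
qed

lemma integrated_count_mono:
  assumes "locally_finite_support \<mu>" "0 < a" "a \<le> r"
  shows "integrated_count (disc_count \<mu>) a \<le> integrated_count (disc_count \<mu>) r"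
proof -
  have "0 \<le> real (disc_count \<mu> a) * (ln r - ln a)" using assms by simp
  then show ?thesis using integrated_count_ge[OF assms] by linarith
qed

lemma integrated_count_nonneg:
  assumes "locally_finite_support \<mu>" "1 \<le> r"
  shows "0 \<le> integrated_count (disc_count \<mu>) r"
  using assms by (subst integrated_count_eq_sum)
    (auto intro!: add_nonneg_nonneg sum_nonneg mult_nonneg_nonneg ln_ge_zero simp: divide_simps)

text \<open>The shift by 5 costs only the factor 1 + \<delta>, because 1 / t \<le> (1 + \<delta>) /
  (t + 5) once t \<ge> 5 / \<delta>. For smaller t the shifted count is bounded and contributes at
  most a multiple of ln r.\<close>

lemma integrated_count_inequality:
  assumes lf: "locally_finite_support \<mu>1" "locally_finite_support \<mu>2" "locally_finite_support \<mu>3"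
    and le: "\<And>t. 4 * disc_count \<mu>1 t \<le> 2 * disc_count \<mu>2 t + disc_count \<mu>3 (t + 5) + C"
    and \<delta>: "\<delta> > 0"
  obtains D where "D \<ge> 0" "\<And>r. 1 \<le> r \<Longrightarrow>
    4 * integrated_count (disc_count \<mu>1) r \<le> 2 * integrated_count (disc_count \<mu>2) r
      + (1 + \<delta>) * integrated_count (disc_count \<mu>3) (r + 5) + D * (ln r + 1)"
proof -
  let ?N1 = "integrated_count (disc_count \<mu>1)" and ?N2 = "integrated_count (disc_count \<mu>2)"
    and ?N3 = "integrated_count (disc_count \<mu>3)"
  define K where "K = real (disc_count \<mu>3 (5 / \<delta> + 5)) + real C"
  \<comment> \<open>The second entry pays for the part of the integrated count up to radius 1, which
    the integration over [1, r] omits.\<close>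
  define D where "D = max K (4 * ?N1 1)"
  have K0: "K \<ge> 0" by (simp add: K_def)
  show thesis
  proof (rule that[of D])
    show "D \<ge> 0" using K0 by (simp add: D_def)
    fix r :: real assume r: "1 \<le> r"
    have 3: "((\<lambda>t. real (disc_count \<mu>3 (t + 5)) / (t + 5)) has_integral (?N3 (r + 5) - ?N3 6)) {1..r}"
      using has_integral_shift_real_ivl[OF integrated_count_diff_has_integral[OF lf(3), of 6 "r + 5"], of 5] r
      by simp
    have inv: "((\<lambda>t. 1 / t) has_integral (ln r - ln 1)) {1..r}"
      by (rule has_integral_inverse_ln) (use r in auto)
    have "4 * (?N1 r - ?N1 1) \<le> 2 * (?N2 r - ?N2 1) + (1 + \<delta>) * (?N3 (r + 5) - ?N3 6) + K * (ln r - ln 1)"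
    proof (rule has_integral_le)
      show "((\<lambda>t. 4 * (real (disc_count \<mu>1 t) / t)) has_integral 4 * (?N1 r - ?N1 1)) {1..r}"
        by (intro has_integral_mult_right integrated_count_diff_has_integral lf) (use r in auto)
      show "((\<lambda>t. 2 * (real (disc_count \<mu>2 t) / t) + (1 + \<delta>) * (real (disc_count \<mu>3 (t + 5)) / (t + 5))
          + K * (1 / t)) has_integral
        2 * (?N2 r - ?N2 1) + (1 + \<delta>) * (?N3 (r + 5) - ?N3 6) + K * (ln r - ln 1)) {1..r}"
        by (intro has_integral_add has_integral_mult_right integrated_count_diff_has_integral lf 3 inv)
          (use r in auto)
      fix t assume "t \<in> {1..r}"
      then have t: "t \<ge> 1" by simp
      have n3: "real (disc_count \<mu>3 (t + 5)) + C \<le> (1 + \<delta>) * (real (disc_count \<mu>3 (t + 5)) / (t + 5)) * t + K"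
      proof (cases "t \<le> 5 / \<delta>")
        case True
        then have "disc_count \<mu>3 (t + 5) \<le> disc_count \<mu>3 (5 / \<delta> + 5)" by (intro disc_count_mono lf) simp
        moreover have "0 \<le> (1 + \<delta>) * (real (disc_count \<mu>3 (t + 5)) / (t + 5)) * t" using t \<delta> by simp
        ultimately show ?thesis unfolding K_def by linarith
      next
        case False
        then have "5 \<le> \<delta> * t" using \<delta> by (simp add: field_simps)
        then have "1 \<le> (1 + \<delta>) * t / (t + 5)" using t by (simp add: field_simps)
        then have "real (disc_count \<mu>3 (t + 5)) * 1 \<le> real (disc_count \<mu>3 (t + 5)) * ((1 + \<delta>) * t / (t + 5))"
          by (rule mult_left_mono) simp
        then show ?thesis unfolding K_def by (simp add: field_simps)
      qed
      have "real (4 * disc_count \<mu>1 t) \<le> real (2 * disc_count \<mu>2 t + disc_count \<mu>3 (t + 5) + C)"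
        using le[of t] of_nat_le_iff by blast
      then have "4 * real (disc_count \<mu>1 t) \<le> 2 * real (disc_count \<mu>2 t)
          + (1 + \<delta>) * (real (disc_count \<mu>3 (t + 5)) / (t + 5)) * t + K"
        using n3 by simp
      then have "4 * real (disc_count \<mu>1 t) / t \<le> (2 * real (disc_count \<mu>2 t)
          + (1 + \<delta>) * (real (disc_count \<mu>3 (t + 5)) / (t + 5)) * t + K) / t"
        using t by (intro divide_right_mono) auto
      then show "4 * (real (disc_count \<mu>1 t) / t) \<le> 2 * (real (disc_count \<mu>2 t) / t)
          + (1 + \<delta>) * (real (disc_count \<mu>3 (t + 5)) / (t + 5)) + K * (1 / t)"
        using t by (simp add: add_divide_distrib)
    qed
    moreover have "0 \<le> ?N2 1" "0 \<le> ?N3 6" by (intro integrated_count_nonneg lf; simp)+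
    moreover have "0 \<le> (1 + \<delta>) * ?N3 6" using \<open>0 \<le> ?N3 6\<close> \<delta> by simp
    moreover have "K * ln r \<le> D * ln r" using r by (intro mult_right_mono) (auto simp: D_def)
    moreover have "4 * ?N1 1 \<le> D" by (simp add: D_def)
    ultimately show "4 * ?N1 r \<le> 2 * ?N2 r + (1 + \<delta>) * ?N3 (r + 5) + D * (ln r + 1)"
      by (simp add: algebra_simps)
  qed
qed

lemma finite_support_if_bounded:
  assumes "locally_finite_support \<mu>" "\<And>r. real (disc_count \<mu> r) \<le> K"
  shows "finite {s. \<mu> s \<noteq> 0}"
proof (rule ccontr)
  assume inf: "infinite {s. \<mu> s \<noteq> 0}"
  obtain F where F: "F \<subseteq> {s. \<mu> s \<noteq> 0}" "finite F" "card F = nat \<lceil>K\<rceil> + 1"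
    using infinite_arbitrarily_large[OF inf] by blast
  obtain r where r: "\<And>s. s \<in> F \<Longrightarrow> norm s \<le> r"
    using finite_imp_bounded[OF F(2)] unfolding bounded_iff by blast
  have "card F = (\<Sum>s\<in>F. 1)" by simp
  also have "\<dots> \<le> (\<Sum>s\<in>F. \<mu> s)"
  proof (rule sum_mono)
    fix s assume "s \<in> F"
    then have "\<mu> s \<noteq> 0" using F(1) by blast
    then show "1 \<le> \<mu> s" by simp
  qed
  also have "\<dots> \<le> disc_count \<mu> r" unfolding disc_count_def
    using F(1) r by (intro sum_mono2 locally_finite_supportD assms) auto
  finally have "real (nat \<lceil>K\<rceil> + 1) \<le> K" using assms(2)[of r] F(3) by linarith
  then show False by linarith
qed

lemma integrated_count_le_if_bounded:
  assumes "locally_finite_support \<mu>" "\<And>r. real (disc_count \<mu> r) \<le> K" "1 \<le> r"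
  shows "integrated_count (disc_count \<mu>) r \<le> integrated_count (disc_count \<mu>) 1 + K * ln r"
proof -
  have "((\<lambda>t. real (disc_count \<mu> t) / t) has_integral
      (integrated_count (disc_count \<mu>) r - integrated_count (disc_count \<mu>) 1)) {1..r}"
    using assms by (intro integrated_count_diff_has_integral) auto
  moreover have "((\<lambda>t. K * (1 / t)) has_integral K * (ln r - ln 1)) {1..r}"
    using assms(3) by (intro has_integral_mult_right has_integral_inverse_ln) auto
  ultimately have "integrated_count (disc_count \<mu>) r - integrated_count (disc_count \<mu>) 1 \<le> K * (ln r - ln 1)"
    by (rule has_integral_le) (use assms(2) in \<open>auto simp: divide_right_mono\<close>)
  then show ?thesis by simp
qed

section \<open>Exceptional sets and growth\<close>

text \<open>On [R, 2 R] the density 1 / t is at least 1 / (2 R). Once the logarithmic measure of the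
  tail of E is below 1/4, E covers at most R / 2 of this interval.\<close>

lemma finite_log_measure_density:
  assumes "finite_log_measure E"
  obtains R0 where "R0 \<ge> 1" "\<And>R. R \<ge> R0 \<Longrightarrow> measure lebesgue ({R..2 * R} - E) \<ge> R / 2"
proof -
  from assms have E: "E \<in> sets lebesgue"
    and fin: "(\<integral>\<^sup>+ t \<in> E \<inter> {1..}. ennreal (1 / t) \<partial>lebesgue) < \<infinity>"
    by (auto simp: finite_log_measure_def)
  define f where "f = (\<lambda>t. ennreal (1 / t) * indicator (E \<inter> {1..}) t)"
  have meas: "f \<in> borel_measurable lebesgue"
    unfolding f_def using E
    by (intro borel_measurable_times_ennreal borel_measurable_indicator measurable_completion) auto
  \<comment> \<open>This is logarithmic measure restricted to E. It is finite, so its tails tend to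
    0 by continuity from above.\<close>
  define \<nu> where "\<nu> = density lebesgue f"
  have \<nu>: "emeasure \<nu> A = (\<integral>\<^sup>+ t. f t * indicator A t \<partial>lebesgue)" if "A \<in> sets lebesgue" for A
    unfolding \<nu>_def by (rule emeasure_density[OF meas that])
  have "(\<lambda>n. emeasure \<nu> {real n..}) \<longlonglongrightarrow> emeasure \<nu> (\<Inter>n. {real n..})"
  proof (rule Lim_emeasure_decseq)
    show "range (\<lambda>n. {real n..}) \<subseteq> sets \<nu>" unfolding \<nu>_def by auto
    show "decseq (\<lambda>n. {real n..})" by (auto simp: decseq_def)
    fix n
    have "emeasure \<nu> {real n..} \<le> (\<integral>\<^sup>+ t. f t \<partial>lebesgue)"
      by (subst \<nu>) (auto intro!: nn_integral_mono simp: indicator_def)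
    also have "\<dots> < \<infinity>" using fin by (simp add: f_def)
    finally show "emeasure \<nu> {real n..} \<noteq> \<infinity>" by simp
  qed
  moreover have "(\<Inter>n. {real n..}) = {}"
    using reals_Archimedean2 by (fastforce simp: not_le[symmetric])
  ultimately have "(\<lambda>n. emeasure \<nu> {real n..}) \<longlonglongrightarrow> 0" by simp
  then have "eventually (\<lambda>n. emeasure \<nu> {real n..} < ennreal (1 / 4)) sequentially"
    by (rule order_tendstoD) simp
  then obtain n where n: "emeasure \<nu> {real n..} < ennreal (1 / 4)"
    by (auto simp: eventually_sequentially)
  show thesis
  proof (rule that[of "max 1 (real n)"])
    fix R assume "R \<ge> max 1 (real n)"
    then have R: "R \<ge> 1" "R \<ge> real n" by auto
    have "emeasure lebesgue (E \<inter> {R..2 * R}) = (\<integral>\<^sup>+ t. indicator (E \<inter> {R..2 * R}) t \<partial>lebesgue)"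
      using E by (intro nn_integral_indicator[symmetric] sets.Int) auto
    also have "\<dots> \<le> (\<integral>\<^sup>+ t. ennreal (2 * R) * (f t * indicator {real n..} t) \<partial>lebesgue)"
    proof (rule nn_integral_mono)
      fix t
      show "indicator (E \<inter> {R..2 * R}) t \<le> ennreal (2 * R) * (f t * indicator {real n..} t)"
      proof (cases "t \<in> E \<inter> {R..2 * R}")
        case True
        then have t: "t \<in> E" "R \<le> t" "t \<le> 2 * R" by auto
        have "(1 :: ennreal) = ennreal 1" by simp
        also have "\<dots> \<le> ennreal (2 * R * (1 / t))"
          using t R by (intro ennreal_leI) (auto simp: field_simps)
        also have "\<dots> = ennreal (2 * R) * ennreal (1 / t)" using R t by (intro ennreal_mult) auto
        finally show ?thesis using t R by (simp add: f_def)
      qed simp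
    qed
    also have "\<dots> = ennreal (2 * R) * emeasure \<nu> {real n..}"
      using meas by (subst \<nu>) (auto intro!: nn_integral_cmult borel_measurable_times_ennreal borel_measurable_indicator)
    also have "\<dots> \<le> ennreal (2 * R) * ennreal (1 / 4)"
      using n by (intro mult_left_mono) auto
    also have "\<dots> = ennreal (R / 2)" using R by (simp flip: ennreal_mult)
    finally have "measure lebesgue (E \<inter> {R..2 * R}) \<le> R / 2"
      unfolding measure_def using R by (intro enn2real_leI) auto
    moreover have "measure lebesgue ({R..2 * R} - E) = measure lebesgue {R..2 * R} - measure lebesgue (E \<inter> {R..2 * R})"
    proof -
      have "{R..2 * R} - E = {R..2 * R} - E \<inter> {R..2 * R}" by auto
      moreover have "E \<inter> {R..2 * R} \<in> lmeasurable"
        by (rule fmeasurableI2[of "{R..2 * R}"]) (use E in auto)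
      ultimately show ?thesis by (simp add: measurable_measure_Diff)
    qed
    ultimately show "measure lebesgue ({R..2 * R} - E) \<ge> R / 2" using R by simp
  qed auto
qed

lemma finite_log_measure_unbounded_compl:
  assumes "finite_log_measure E"
  obtains r where "r \<ge> R" "r \<notin> E"
proof -
  obtain R0 where R0: "R0 \<ge> 1" "\<And>R. R \<ge> R0 \<Longrightarrow> measure lebesgue ({R..2 * R} - E) \<ge> R / 2"
    using finite_log_measure_density[OF assms] by blast
  define R' where "R' = max R R0"
  have "measure lebesgue ({R'..2 * R'} - E) > 0"
  proof -
    have "R' \<ge> R0" by (simp add: R'_def)
    then show ?thesis using R0(1) R0(2)[of R'] by linarith
  qed
  then have "{R'..2 * R'} - E \<noteq> {}" by (metis measure_empty less_irrefl)
  then obtain x where "x \<in> {R'..2 * R'}" "x \<notin> E" by blast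
  then show thesis using that[of x] by (simp add: R'_def)
qed

text \<open>Allows the radii of all circles that meet the countable set \<open>sing\<close> to be
  added to an exceptional set.\<close>

lemma finite_log_measure_Un_countable:
  assumes "finite_log_measure E" "countable B"
  shows "finite_log_measure (E \<union> B)"
proof -
  have B: "B \<in> null_sets lebesgue" using assms(2)
    by (simp add: countable_imp_null_set_lborel null_sets_completionI)
  have "(\<integral>\<^sup>+ t \<in> (E \<union> B) \<inter> {1..}. ennreal (1 / t) \<partial>lebesgue) = (\<integral>\<^sup>+ t \<in> E \<inter> {1..}. ennreal (1 / t) \<partial>lebesgue)"
    by (rule nn_integral_cong_AE, rule AE_mp[OF AE_not_in[OF B]]) (auto simp: indicator_def)
  then show ?thesis using assms(1) B unfolding finite_log_measure_def by auto
qed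

text \<open>Integrate L(x + 5) - L(x) over [R, 2 R] for L = ln N. The good radii contribute at least
  c R / 2. On the other hand, the integral telescopes to two intervals of length 5 at the ends,
  hence is O(R powr \<sigma>) with \<sigma> < 1.\<close>

lemma geometric_growth_contradiction:
  fixes N :: "real \<Rightarrow> real"
  assumes E: "finite_log_measure E" and R0: "R0 \<ge> 1"
    and mono: "\<And>r s. R0 \<le> r \<Longrightarrow> r \<le> s \<Longrightarrow> N r \<le> N s"
    and pos: "N R0 > 0"
    and \<sigma>: "0 < \<sigma>" "\<sigma> < 1" and up: "\<And>r. R0 \<le> r \<Longrightarrow> N r \<le> exp (r powr \<sigma>)"
    and \<eta>: "\<eta> > 0" and growth: "\<And>r. R0 \<le> r \<Longrightarrow> r \<notin> E \<Longrightarrow> N (r + 5) \<ge> (1 + \<eta>) * N r"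
  shows False
proof -
  define L where "L = (\<lambda>r. ln (N r))"
  define c where "c = ln (1 + \<eta>)"
  have c: "c > 0" using \<eta> by (simp add: c_def)
  have Npos: "N r > 0" if "R0 \<le> r" for r using mono[of R0 r] pos that by simp
  have Lmono: "L r \<le> L s" if "R0 \<le> r" "r \<le> s" for r s
    using mono[OF that] Npos[of r] that by (simp add: L_def)
  have Lint: "L integrable_on {r..s}" if "R0 \<le> r" for r s
    by (rule integrable_on_mono_on) (use that Lmono in \<open>auto simp: mono_on_def\<close>)
  have Lup: "L r \<le> r powr \<sigma>" if "R0 \<le> r" for r
    using up[OF that] Npos[OF that] by (metis L_def ln_exp ln_le_cancel_iff exp_gt_zero)
  obtain R1 where R1: "\<And>R. R \<ge> R1 \<Longrightarrow> measure lebesgue ({R..2 * R} - E) \<ge> R / 2"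
    using finite_log_measure_density[OF E] by blast
  \<comment> \<open>The bound 5 on R gives R + 5 \<le> 2 R, so that the two ranges of integration
    overlap and the common part [R + 5, 2 R] cancels.\<close>
  have main: "c * (R / 2) \<le> 5 * (2 * R + 5) powr \<sigma> - 5 * L R0" if "R \<ge> max (max R0 R1) 5" for R
  proof -
    have R: "R \<ge> R0" "R \<ge> R1" "R \<ge> 5" using that by auto
    define A where "A = {R..2 * R} - E"
    have A: "A \<in> lmeasurable" unfolding A_def
      by (rule fmeasurableI2[of "{R..2 * R}"]) (use E in \<open>auto simp: finite_log_measure_def\<close>)
    have "(indicat_real A has_integral measure lebesgue A) UNIV"
      using A by (simp add: lmeasurable_iff_has_integral)
    then have "((\<lambda>x. c * indicat_real A x) has_integral c * measure lebesgue A) UNIV"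
      by (rule has_integral_mult_right)
    then have "((\<lambda>x. if x \<in> {R..2 * R} then c * indicat_real A x else 0) has_integral c * measure lebesgue A) UNIV"
      by (rule has_integral_eq[rotated]) (auto simp: A_def indicator_def)
    then have 1: "((\<lambda>x. c * indicat_real A x) has_integral c * measure lebesgue A) {R..2 * R}"
      by (simp only: has_integral_restrict_UNIV)
    have "((\<lambda>x. L (x + 5)) has_integral integral {R + 5..2 * R + 5} L) {R..2 * R}"
      using has_integral_shift_real_ivl[OF integrable_integral[OF Lint[of "R + 5" "2 * R + 5"]], of 5] R by simp
    then have 2: "((\<lambda>x. L (x + 5) - L x) has_integral (integral {R + 5..2 * R + 5} L - integral {R..2 * R} L)) {R..2 * R}"
      by (intro has_integral_diff integrable_integral Lint R)
    have "c * measure lebesgue A \<le> integral {R + 5..2 * R + 5} L - integral {R..2 * R} L"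
    proof (rule has_integral_le[OF 1 2])
      fix x assume x: "x \<in> {R..2 * R}"
      show "c * indicat_real A x \<le> L (x + 5) - L x"
      proof (cases "x \<in> A")
        case True
        then have "(1 + \<eta>) * N x \<le> N (x + 5)" using growth[of x] R x by (auto simp: A_def)
        moreover have "0 < (1 + \<eta>) * N x" using Npos[of x] \<eta> R x by simp
        ultimately have "ln ((1 + \<eta>) * N x) \<le> L (x + 5)" unfolding L_def
          by (subst ln_le_cancel_iff) auto
        then show ?thesis using True Npos[of x] \<eta> R x by (simp add: L_def c_def ln_mult)
      next
        case False
        then show ?thesis using Lmono[of x "x + 5"] R x by simp
      qed
    qed
    also have "integral {R + 5..2 * R + 5} L = integral {R + 5..2 * R} L + integral {2 * R..2 * R + 5} L"
      using Henstock_Kurzweil_Integration.integral_combine[of "R + 5" "2 * R" "2 * R + 5" L] Lint R by simp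
    also have "integral {R..2 * R} L = integral {R..R + 5} L + integral {R + 5..2 * R} L"
      using Henstock_Kurzweil_Integration.integral_combine[of "R" "R + 5" "2 * R" L] Lint R by simp
    finally have "c * measure lebesgue A \<le> integral {2 * R..2 * R + 5} L - integral {R..R + 5} L" by simp
    moreover have "integral {2 * R..2 * R + 5} L \<le> integral {2 * R..2 * R + 5} (\<lambda>_. L (2 * R + 5))"
      by (intro integral_le Lint) (use R Lmono R0 in auto)
    moreover have "integral {R..R + 5} L \<ge> integral {R..R + 5} (\<lambda>_. L R0)"
      by (intro integral_le Lint) (use R Lmono in auto)
    ultimately have "c * measure lebesgue A \<le> 5 * L (2 * R + 5) - 5 * L R0" by simp
    moreover have "L (2 * R + 5) \<le> (2 * R + 5) powr \<sigma>" using R R0 by (intro Lup) simp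
    moreover have "c * (R / 2) \<le> c * measure lebesgue A"
      using R1[OF R(2)] c unfolding A_def by (intro mult_left_mono) auto
    ultimately show ?thesis by linarith
  qed
  have "((\<lambda>R. (5 * (2 * R + 5) powr \<sigma> - 5 * L R0) / R) \<longlongrightarrow> 0) at_top"
    using \<sigma> by real_asymp
  then have "eventually (\<lambda>R. (5 * (2 * R + 5) powr \<sigma> - 5 * L R0) / R < c / 2) at_top"
    by (rule order_tendstoD) (use c in simp)
  then have "eventually (\<lambda>R::real. False) at_top"
    using eventually_ge_at_top[of "max (max R0 R1) 5"]
  proof eventually_elim
    case (elim R)
    then have "R > 0" by simp
    with elim(1) have "5 * (2 * R + 5) powr \<sigma> - 5 * L R0 < c * (R / 2)" by (simp add: field_simps)
    then show False using main[OF elim(2)] by simp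
  qed
  then show False by simp
qed

lemma hyper_order_less_1_bound:
  assumes "hyper_order w < 1"
  obtains \<sigma> where "0 < \<sigma>" "\<sigma> < 1" "eventually (\<lambda>r. nevanlinna_T r w \<le> exp (r powr \<sigma>)) at_top"
proof -
  from assms obtain c where c: "hyper_order w < ereal c" "ereal c < 1"
    using ereal_dense2 by blast
  \<comment> \<open>The hyper-order may be negative; the entry 1/2 keeps the exponent
    positive.\<close>
  define \<sigma> where "\<sigma> = max c (1 / 2)"
  have ev: "eventually (\<lambda>r. ereal (ln (ln (nevanlinna_T r w)) / ln r) < ereal c) at_top"
    using c(1) unfolding hyper_order_def by (rule Limsup_lessD)
  have "eventually (\<lambda>r. nevanlinna_T r w \<le> exp (r powr \<sigma>)) at_top"
    using ev eventually_gt_at_top[of 1]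
  proof eventually_elim
    case (elim r)
    let ?T = "nevanlinna_T r w"
    show ?case
    \<comment> \<open>The iterated logarithm is informative only for T > 1; otherwise the bound is
      trivial.\<close>
    proof (cases "?T > 1")
      case False
      moreover have "(1::real) \<le> exp (r powr \<sigma>)" by simp
      ultimately show ?thesis by linarith
    next
      case True
      then have pos: "ln ?T > 0" by simp
      have "ln (ln ?T) / ln r \<le> \<sigma>" using elim(1) by (simp add: \<sigma>_def)
      then have "ln (ln ?T) \<le> \<sigma> * ln r" using elim(2) by (simp add: field_simps)
      then have "exp (ln (ln ?T)) \<le> exp (\<sigma> * ln r)" by simp
      then have "ln ?T \<le> r powr \<sigma>" using pos elim(2) by (simp add: powr_def)
      then have "exp (ln ?T) \<le> exp (r powr \<sigma>)" by simp
      then show ?thesis using True by simp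
    qed
  qed
  moreover have "0 < \<sigma>" "\<sigma> < 1" using c(2) by (auto simp: \<sigma>_def)
  ultimately show thesis using that by blast
qed

section \<open>Jensen's formula\<close>

lemma has_integral_mean_value:
  fixes f :: "complex \<Rightarrow> complex"
  assumes "f holomorphic_on cball 0 r" "0 < r"
  shows "((\<lambda>\<theta>. f (of_real r * cis \<theta>)) has_integral (2 * pi * f 0)) {0..2 * pi}"
proof -
  have "((\<lambda>u. f u / (u - 0)) has_contour_integral (2 * of_real pi * \<i> * f 0)) (circlepath 0 r)"
    using assms by (intro Cauchy_integral_circlepath_simple) auto
  then have "((\<lambda>t. f (0 + r * cis t) / (0 + r * cis t - 0) * r * \<i> * cis t) has_integral (2 * of_real pi * \<i> * f 0)) {0..2 * pi}"
    unfolding circlepath_def by (subst (asm) has_contour_integral_part_circlepath_iff) auto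
  then have "((\<lambda>t. f (r * cis t) * \<i>) has_integral (2 * of_real pi * \<i> * f 0)) {0..2 * pi}"
    by (rule has_integral_eq[rotated]) (use assms(2) in auto)
  then have "((\<lambda>t. (- \<i>) * (f (r * cis t) * \<i>)) has_integral ((- \<i>) * (2 * of_real pi * \<i> * f 0))) {0..2 * pi}"
    by (rule has_integral_mult_right)
  then show ?thesis by (simp add: algebra_simps)
qed

text \<open>A zero-free holomorphic function on a disc has a logarithm, and the mean value property
  applies to the real part of that logarithm.\<close>

lemma has_integral_ln_norm_mean_value:
  fixes f :: "complex \<Rightarrow> complex"
  assumes "f holomorphic_on ball 0 R" "\<And>z. z \<in> ball 0 R \<Longrightarrow> f z \<noteq> 0" "0 < r" "r < R"
  shows "((\<lambda>\<theta>. ln (norm (f (of_real r * cis \<theta>)))) has_integral (2 * pi * ln (norm (f 0)))) {0..2 * pi}"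
proof -
  obtain g where g: "g holomorphic_on ball 0 R" "\<And>z. z \<in> ball 0 R \<Longrightarrow> exp (g z) = f z"
    using holomorphic_logarithm_exists[OF convex_ball open_ball assms(1,2), of 0] assms(3,4) by auto
  have ln: "ln (norm (f z)) = Re (g z)" if "z \<in> ball 0 R" for z
    using g(2)[OF that] by (metis norm_exp_eq_Re ln_exp)
  have "g holomorphic_on cball 0 r" using g(1) by (rule holomorphic_on_subset) (use assms in auto)
  then have "((\<lambda>\<theta>. Re (g (of_real r * cis \<theta>))) has_integral Re (2 * pi * g 0)) {0..2 * pi}"
    by (intro has_integral_Re has_integral_mean_value assms)
  then have "((\<lambda>\<theta>. ln (norm (f (of_real r * cis \<theta>)))) has_integral Re (2 * pi * g 0)) {0..2 * pi}"
    by (rule has_integral_eq[rotated]) (use assms ln in \<open>auto simp: norm_mult\<close>)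
  moreover have "Re (2 * pi * g 0) = 2 * pi * ln (norm (f 0))" using ln[of 0] assms by simp
  ultimately show ?thesis by simp
qed

text \<open>For s outside the circle, z - s has no zero in the disc. For s inside, it is replaced by
  r - cnj s * z / r, which has the same modulus on the circle and the value r at 0, and whose zero,
  if any, is reflected to the outside.\<close>

lemma has_integral_ln_dist_circle:
  fixes s :: complex
  assumes "0 < r" "norm s \<noteq> r"
  shows "((\<lambda>\<theta>. ln (norm (of_real r * cis \<theta> - s))) has_integral (2 * pi * ln (max r (norm s)))) {0..2 * pi}"
proof (cases "r < norm s")
  case True
  have "((\<lambda>\<theta>. ln (norm (of_real r * cis \<theta> - s))) has_integral (2 * pi * ln (norm (0 - s)))) {0..2 * pi}"
    by (rule has_integral_ln_norm_mean_value[where R = "norm s"])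
      (use assms True in \<open>auto intro!: holomorphic_intros\<close>)
  then show ?thesis using True by simp
next
  case False
  then have s: "norm s < r" using assms by simp
  \<comment> \<open>For s \<noteq> 0 this is the modulus of the only zero of \<open>f\<close>, and
    it exceeds r. For s = 0 there is no zero and any radius beyond r will do.\<close>
  define R where "R = (if s = 0 then 2 * r else r\<^sup>2 / norm s)"
  define f where "f = (\<lambda>z :: complex. of_real r - cnj s * z / of_real r)"
  have "((\<lambda>\<theta>. ln (norm (f (of_real r * cis \<theta>)))) has_integral (2 * pi * ln (norm (f 0)))) {0..2 * pi}"
  proof (rule has_integral_ln_norm_mean_value)
    show "f holomorphic_on ball 0 R" unfolding f_def using assms by (intro holomorphic_intros) auto
    show "r < R" using s assms by (auto simp: R_def field_simps power2_eq_square)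
    fix z :: complex assume z: "z \<in> ball 0 R"
    show "f z \<noteq> 0"
    proof
      assume "f z = 0"
      then have "cnj s * z = of_real r * of_real r" using assms by (simp add: f_def field_simps)
      then have "norm (cnj s * z) = norm (of_real r * of_real r :: complex)" by simp
      then have "norm s * norm z = r\<^sup>2" using assms by (simp add: norm_mult power2_eq_square)
      then show False using z assms by (auto simp: R_def field_simps split: if_splits)
    qed
  qed fact
  moreover have "norm (f (of_real r * cis \<theta>)) = norm (of_real r * cis \<theta> - s)" for \<theta>
  proof -
    have "of_real r * cis \<theta> - s = cis \<theta> * cnj (f (of_real r * cis \<theta>))"
      using assms by (simp add: f_def algebra_simps cis_cnj cis_mult)
    then show ?thesis by (simp add: norm_mult)
  qed
  moreover have "norm (f 0) = r" using assms by (simp add: f_def)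
  ultimately show ?thesis using s by simp
qed

lemma ln_norm_prod_powi:
  fixes z :: complex
  assumes "finite S" "\<And>s. s \<in> S \<Longrightarrow> z \<noteq> s"
  shows "ln (norm (\<Prod>s\<in>S. (z - s) powi k s)) = (\<Sum>s\<in>S. of_int (k s) * ln (norm (z - s)))"
proof -
  have "ln (norm (\<Prod>s\<in>S. (z - s) powi k s)) = ln (\<Prod>s\<in>S. norm (z - s) powi k s)"
    by (simp add: prod_norm[symmetric] norm_power_int)
  also have "\<dots> = (\<Sum>s\<in>S. ln (norm (z - s) powi k s))"
    using assms by (intro ln_prod) auto
  also have "\<dots> = (\<Sum>s\<in>S. of_int (k s) * ln (norm (z - s)))"
    using assms by (intro sum.cong refl) (simp add: power_int_def ln_realpow ln_inverse)
  finally show ?thesis .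
qed

lemma log_plus_norm_eq: "x > 0 \<Longrightarrow> log_plus x = max 0 (ln x)"
  by (auto simp: log_plus_def max_def)

section \<open>Orders, counts and factorization of a meromorphic function\<close>

locale nonzero_mero =
  fixes w :: "complex \<Rightarrow> complex"
  assumes mero: "w meromorphic_on UNIV" and nz: "\<forall>\<^sub>\<approx>z. w z \<noteq> 0"
begin

abbreviation zero_mult :: "complex \<Rightarrow> nat" where "zero_mult s \<equiv> nat (zorder w s)"
abbreviation pole_mult :: "complex \<Rightarrow> nat" where "pole_mult s \<equiv> nat (- zorder w s)"

text \<open>Besides zeros and poles this contains the points at which \<open>w\<close> carries an
  arbitrary value instead of its limit. There \<open>zorder\<close> may be 0 although pointwise
  identities for \<open>w\<close> fail.\<close>

definition "sing = {z. \<not> (w analytic_on {z} \<and> w z \<noteq> 0)}"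

lemma w_expansion: "(\<lambda>t. w (z + t)) has_laurent_expansion laurent_expansion w z"
  using mero meromorphic_on_imp_has_laurent_expansion by blast

lemma ev_nz: "eventually (\<lambda>z. w z \<noteq> 0) (at x)"
  using eventually_cosparse_imp_eventually_at[OF nz, of x UNIV] by simp

lemma expansion_nz: "laurent_expansion w z \<noteq> 0"
  using has_laurent_expansion_eventually_nonzero_iff[OF w_expansion[of z]] ev_nz by simp

lemma zorder_eq: "fls_subdegree (laurent_expansion w z) = zorder w z"
  using has_laurent_expansion_zorder[OF w_expansion expansion_nz] by simp

lemma mero_at: "w meromorphic_on A"
  using mero by (rule meromorphic_on_subset) simp

lemma is_pole_iff: "is_pole w z \<longleftrightarrow> zorder w z < 0"
  using is_pole_fls_subdegree_iff[OF w_expansion[of z]] by (simp add: zorder_eq)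

lemma is_pole_inverse_iff: "is_pole (\<lambda>z. 1 / w z) z \<longleftrightarrow> 0 < zorder w z"
proof -
  have "(\<lambda>t. 1 / w (z + t)) has_laurent_expansion 1 / laurent_expansion w z"
    by (intro has_laurent_expansion_divide has_laurent_expansion_1 w_expansion)
  moreover have "fls_subdegree (1 / laurent_expansion w z) = - zorder w z"
    using expansion_nz by (simp add: fls_divide_subdegree zorder_eq)
  ultimately show ?thesis
    using is_pole_fls_subdegree_iff[of "\<lambda>z. 1 / w z" z] by auto
qed

lemma sing_sparse: "sing sparse_in UNIV"
  using eventually_conj[OF meromorphic_on_imp_analytic_cosparse[OF mero] nz]
  by (simp add: eventually_cosparse sing_def)

lemma zorder_nonzero_imp_sing: "zorder w z \<noteq> 0 \<Longrightarrow> z \<in> sing"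
  using zorder_eq_0I by (auto simp: sing_def)

lemma finite_zorder_nonzero: "finite {z. norm z \<le> r \<and> zorder w z \<noteq> 0}"
proof (rule finite_subset)
  show "{z. norm z \<le> r \<and> zorder w z \<noteq> 0} \<subseteq> cball 0 r \<inter> sing"
    using zorder_nonzero_imp_sing by auto
  show "finite (cball 0 r \<inter> sing)"
    by (rule sparse_in_compact_finite[OF sparse_in_subset[OF sing_sparse]]) auto
qed

lemma locally_finite: "locally_finite_support zero_mult" "locally_finite_support pole_mult"
    "locally_finite_support (\<lambda>z. if 0 < zorder w z then 1 else 0)"
  unfolding locally_finite_support_def
  by (auto intro: finite_subset[OF _ finite_zorder_nonzero])

lemma pole_count_eq: "(\<lambda>r. pole_count r w) = disc_count pole_mult"
proof
  fix r
  have "{z. cmod z \<le> r \<and> is_pole w z} = {s. cmod s \<le> r \<and> pole_mult s \<noteq> 0}"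
    by (auto simp: is_pole_iff)
  then show "pole_count r w = disc_count pole_mult r" by (simp add: pole_count_def disc_count_def)
qed

lemma distinct_zero_count_eq:
  "(\<lambda>r. distinct_pole_count r (\<lambda>z. 1 / w z)) = disc_count (\<lambda>z. if 0 < zorder w z then 1 else 0)"
proof
  fix r
  have "{z. cmod z \<le> r \<and> is_pole (\<lambda>z. 1 / w z) z} = {s. cmod s \<le> r \<and> (if 0 < zorder w s then 1 else 0) \<noteq> (0::nat)}"
    by (auto simp: is_pole_inverse_iff)
  then show "distinct_pole_count r (\<lambda>z. 1 / w z) = disc_count (\<lambda>z. if 0 < zorder w z then 1 else 0) r"
    by (simp add: distinct_pole_count_def disc_count_def)
qed

lemma nevanlinna_N_eq: "nevanlinna_N r w = integrated_count (disc_count pole_mult) r"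
  by (simp add: nevanlinna_N_def pole_count_eq)

lemma nevanlinna_Nbar_inverse_eq: "nevanlinna_Nbar r (\<lambda>z. 1 / w z) =
    integrated_count (disc_count (\<lambda>z. if 0 < zorder w z then 1 else 0)) r"
  by (simp add: nevanlinna_Nbar_def distinct_zero_count_eq)

text \<open>No condition on r is imposed: if the integrand is not integrable,
  \<open>integral\<close> takes the value 0.\<close>

lemma proximity_nonneg: "0 \<le> proximity_fun r w"
proof -
  define f where "f = (\<lambda>\<theta>. log_plus (norm (w (of_real r * cis \<theta>))))"
  have "0 \<le> integral {0..2*pi} f"
  proof (cases "f integrable_on {0..2*pi}")
    case True
    then show ?thesis by (rule integral_nonneg) (auto simp: f_def log_plus_def)
  qed (simp add: not_integrable_integral)
  then show ?thesis by (simp add: proximity_fun_def f_def)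
qed

text \<open>Multiplication by Q cancels all zeros and poles in U. The product extends to a zero-free
  holomorphic function, which has a logarithm because U is convex.\<close>

lemma factorization:
  assumes U: "open U" "convex U" "U \<noteq> {}" and S: "finite S" "\<And>z. z \<in> U \<Longrightarrow> zorder w z \<noteq> 0 \<longleftrightarrow> z \<in> S"
  obtains g where "g holomorphic_on U"
    "\<forall>\<^sub>\<approx>z\<in>U. w z = (\<Prod>s\<in>S. (z - s) powi zorder w s) * exp (g z)"
    "\<And>z. z \<in> U \<Longrightarrow> z \<notin> sing \<Longrightarrow> w z = (\<Prod>s\<in>S. (z - s) powi zorder w s) * exp (g z)"
proof -
  define Q where "Q = (\<lambda>z. \<Prod>s\<in>S. (z - s) powi (- zorder w s))"
  define h where "h = (\<lambda>z. w z * Q z)"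
  have merQ: "Q meromorphic_on A" for A
    unfolding Q_def by (intro meromorphic_intros)
  have merh: "h meromorphic_on A" for A
    unfolding h_def by (intro meromorphic_intros mero_at merQ)
  have "\<forall>\<^sub>\<approx>z. z \<notin> S" using S(1) by (intro eventually_not_in_cosparse finite_imp_sparse)
  then have evS: "eventually (\<lambda>z. z \<notin> S) (at x)" for x
    by (rule eventually_cosparse_imp_eventually_at) simp
  have Qnz: "Q z \<noteq> 0" if "z \<notin> S" for z
    using that S(1) by (auto simp: Q_def)
  have evQ: "eventually (\<lambda>z. Q z \<noteq> 0) (at x)" for x
    using evS[of x] by eventually_elim (rule Qnz)
  have evh: "eventually (\<lambda>z. h z \<noteq> 0) (at x)" for x
    using evQ[of x] ev_nz[of x] by eventually_elim (simp add: h_def)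
  \<comment> \<open>Only the factor with s = z has nonzero order at z, and its order is opposite to
    that of \<open>w\<close>.\<close>
  have zh: "zorder h z = 0" if z: "z \<in> U" for z
  proof -
    have lin: "zorder (\<lambda>x. (x - s) powi k) z = (if s = z then k else 0)" for s k
    proof (cases "s = z")
      case True
      have "zorder (\<lambda>x. (x - z) powi k) z = k * zorder (\<lambda>x. x - z) z"
        by (rule zorder_power_int)
          (auto intro!: meromorphic_intros eventually_frequently simp: eventually_at_filter)
      also have "zorder (\<lambda>x. x - z) z = 1"
        using zorder_eqI[of UNIV z "\<lambda>_. 1" "\<lambda>x. x - z" 1] by auto
      finally show ?thesis using True by simp
    next
      case False
      have "(\<lambda>x. (x - s) powi k) analytic_on {z}"
        using False by (intro analytic_intros) auto
      then show ?thesis using False by (simp add: zorder_eq_0I)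
    qed
    have "zorder Q z = (\<Sum>s\<in>S. zorder (\<lambda>x. (x - s) powi (- zorder w s)) z)"
      unfolding Q_def by (rule zorder_prod) (use evQ[of z] in \<open>auto intro!: meromorphic_intros simp: Q_def\<close>)
    also have "\<dots> = (\<Sum>s\<in>S. if s = z then - zorder w z else 0)"
      by (intro sum.cong refl) (simp add: lin)
    also have "\<dots> = - zorder w z" using S(1) S(2)[OF z] by (cases "z \<in> S") auto
    finally have "zorder Q z = - zorder w z" .
    moreover have "zorder h z = zorder w z + zorder Q z"
      unfolding h_def using ev_nz[of z] evQ[of z]
      by (intro zorder_mult mero_at merQ eventually_frequently) auto
    ultimately show ?thesis by simp
  qed
  have lim: "\<exists>c. c \<noteq> 0 \<and> h \<midarrow>z\<rightarrow> c" if "z \<in> U" for z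
  proof -
    have L: "(\<lambda>t. h (z + t)) has_laurent_expansion laurent_expansion h z"
      using meromorphic_on_imp_has_laurent_expansion[OF merh, of z UNIV] by simp
    have nz: "laurent_expansion h z \<noteq> 0"
      using has_laurent_expansion_eventually_nonzero_iff[OF L] evh by simp
    have sd: "fls_subdegree (laurent_expansion h z) = 0"
      using has_laurent_expansion_zorder[OF L nz] zh[OF that] by simp
    have "h \<midarrow>z\<rightarrow> laurent_expansion h z $$ 0"
      by (rule has_laurent_expansion_imp_tendsto[OF L]) (simp add: sd)
    moreover have "laurent_expansion h z $$ 0 \<noteq> 0"
      using nz sd by (metis nth_fls_subdegree_zero_iff)
    ultimately show ?thesis by blast
  qed
  define h' where "h' = remove_sings h"
  have h'an: "h' analytic_on {z}" and h'nz: "h' z \<noteq> 0" if zU: "z \<in> U" for z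
  proof -
    obtain c where c: "c \<noteq> 0" "h \<midarrow>z\<rightarrow> c" using lim[OF zU] by blast
    show "h' analytic_on {z}" unfolding h'_def
      by (rule remove_sings_analytic_at[OF meromorphic_on_isolated_singularity[OF merh] c(2)])
    show "h' z \<noteq> 0" unfolding h'_def using remove_sings_eqI[OF c(2)] c(1) by simp
  qed
  have h'hol: "h' holomorphic_on U"
    using h'an analytic_on_analytic_at[of h' U] by (intro analytic_imp_holomorphic) blast
  obtain z0 where "z0 \<in> U" using U(3) by blast
  obtain g where g: "g holomorphic_on U" "\<And>z. z \<in> U \<Longrightarrow> exp (g z) = h' z"
    using holomorphic_logarithm_exists[OF U(2,1) h'hol h'nz \<open>z0 \<in> U\<close>] by blast
  have "\<forall>\<^sub>\<approx>z. h' z = h z" unfolding h'_def using merh by (rule eventually_remove_sings_eq)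
  have ev: "eventually (\<lambda>z. w z = (\<Prod>s\<in>S. (z - s) powi zorder w s) * exp (g z)) (at x)" if "x \<in> U" for x
  proof -
    have "eventually (\<lambda>z. h' z = h z) (at x)"
      using eventually_cosparse_imp_eventually_at[OF \<open>\<forall>\<^sub>\<approx>z. h' z = h z\<close>, of x UNIV] by simp
    moreover have "eventually (\<lambda>z. z \<in> U) (at x)"
      using U(1) that by (rule eventually_at_in_open')
    ultimately show ?thesis using evS[of x]
    proof eventually_elim
      case (elim z)
      have "(\<Prod>s\<in>S. (z - s) powi zorder w s) * Q z = (\<Prod>s\<in>S. (z - s) powi zorder w s * (z - s) powi (- zorder w s))"
        by (simp add: Q_def prod.distrib)
      also have "\<dots> = 1"
      proof (intro prod.neutral ballI)
        fix s assume "s \<in> S"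
        then have "(z - s) powi zorder w s \<noteq> 0" using elim(3) by auto
        then show "(z - s) powi zorder w s * (z - s) powi (- zorder w s) = 1"
          unfolding power_int_minus by (rule right_inverse)
      qed
      finally have "(\<Prod>s\<in>S. (z - s) powi zorder w s) * Q z = 1" .
      then show ?case using g(2)[OF elim(2)] elim(1) by (simp add: h_def algebra_simps)
    qed
  qed
  \<comment> \<open>Off \<open>sing\<close> both sides are continuous at z, so agreement on a
    punctured neighbourhood extends to z itself.\<close>
  have "w z = (\<Prod>s\<in>S. (z - s) powi zorder w s) * exp (g z)" if z: "z \<in> U" "z \<notin> sing" for z
  proof -
    have "z \<notin> S" using z S(2) zorder_nonzero_imp_sing by blast
    have "w \<midarrow>z\<rightarrow> w z" using z(2) by (simp add: sing_def analytic_at_imp_isCont isContD)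
    moreover have "(\<lambda>z. (\<Prod>s\<in>S. (z - s) powi zorder w s) * exp (g z)) \<midarrow>z\<rightarrow>
        (\<Prod>s\<in>S. (z - s) powi zorder w s) * exp (g z)"
    proof (intro tendsto_intros tendsto_power_int)
      show "z - s \<noteq> 0" if "s \<in> S" for s using that \<open>z \<notin> S\<close> by auto
      show "g \<midarrow>z\<rightarrow> g z"
        using holomorphic_on_imp_continuous_on[OF g(1)] U(1) z(1)
        by (simp add: continuous_on_eq_continuous_at isContD)
    qed
    then have "w \<midarrow>z\<rightarrow> (\<Prod>s\<in>S. (z - s) powi zorder w s) * exp (g z)"
      using tendsto_cong[OF ev[OF z(1)]] by blast
    ultimately show ?thesis by (rule LIM_unique)
  qed
  moreover have "\<forall>\<^sub>\<approx>z\<in>U. w z = (\<Prod>s\<in>S. (z - s) powi zorder w s) * exp (g z)"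
    using ev by (simp add: eventually_cosparse_open_eq[OF U(1)])
  ultimately show thesis using that g(1) by blast
qed

end

context nonzero_mero begin

lemma circle_ln_norm_continuous:
  assumes "\<And>z. norm z = r \<Longrightarrow> z \<notin> sing" "0 \<le> r"
  shows "continuous_on A (\<lambda>\<theta>. ln (norm (w (of_real r * cis \<theta>))))"
proof (rule continuous_at_imp_continuous_on, rule ballI)
  fix \<theta>
  have z: "of_real r * cis \<theta> \<notin> sing" using assms by (simp add: norm_mult)
  then have w: "isCont w (of_real r * cis \<theta>)" by (simp add: sing_def analytic_at_imp_isCont)
  have "continuous_on UNIV (\<lambda>\<theta>. of_real r * cis \<theta>)" by (intro continuous_intros)
  then have "isCont (\<lambda>\<theta>. of_real r * cis \<theta>) \<theta>" by (simp add: continuous_on_eq_continuous_at)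
  then have "isCont (\<lambda>\<theta>. w (of_real r * cis \<theta>)) \<theta>" using w by (rule isCont_o2)
  then have "isCont (\<lambda>\<theta>. norm (w (of_real r * cis \<theta>))) \<theta>" by (rule continuous_norm)
  moreover have "isCont ln (norm (w (of_real r * cis \<theta>)))" using z by (intro isCont_ln) (simp add: sing_def)
  ultimately show "isCont (\<lambda>\<theta>. ln (norm (w (of_real r * cis \<theta>)))) \<theta>" by (rule isCont_o2)
qed

lemma log_plus_has_integral:
  assumes "\<And>z. norm z = r \<Longrightarrow> z \<notin> sing" "0 \<le> r"
  shows "((\<lambda>\<theta>. log_plus (norm (w (of_real r * cis \<theta>)))) has_integral (2 * pi * proximity_fun r w)) {0..2 * pi}"
proof -
  have "(\<lambda>\<theta>. max 0 (ln (norm (w (of_real r * cis \<theta>))))) integrable_on {0..2 * pi}"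
    by (intro integrable_continuous_interval continuous_intros circle_ln_norm_continuous assms)
  moreover have "(\<lambda>\<theta>. max 0 (ln (norm (w (of_real r * cis \<theta>))))) = (\<lambda>\<theta>. log_plus (norm (w (of_real r * cis \<theta>))))"
    using assms by (intro ext log_plus_norm_eq[symmetric]) (auto simp: norm_mult sing_def)
  ultimately show ?thesis by (simp add: proximity_fun_def has_integral_iff)
qed

text \<open>The constant is the logarithm of the modulus of the leading Laurent coefficient at the origin.\<close>

lemma jensen_formula:
  obtains C where "\<And>r. 0 < r \<Longrightarrow> (\<And>z. norm z = r \<Longrightarrow> z \<notin> sing) \<Longrightarrow>
    ((\<lambda>\<theta>. ln (norm (w (of_real r * cis \<theta>)))) has_integral
      2 * pi * (C + integrated_count (disc_count zero_mult) r - integrated_count (disc_count pole_mult) r)) {0..2 * pi}"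
proof
  fix r :: real
  assume r: "0 < r" and good: "\<And>z. norm z = r \<Longrightarrow> z \<notin> sing"
  \<comment> \<open>The constant must not depend on r, whereas \<open>S\<close> and \<open>g\<close>
    below do; hence this intrinsic description as a limit at the origin.\<close>
  define L where "L = (THE c. (\<lambda>z. w z * z powi (- zorder w 0)) \<midarrow>0\<rightarrow> c)"
  \<comment> \<open>The margin 1 places the closed disc of radius r inside the domain of
    \<open>g\<close>.\<close>
  let ?U = "ball (0::complex) (r + 1)"
  define S where "S = {z \<in> ?U. zorder w z \<noteq> 0}"
  have finS: "finite S" unfolding S_def
    by (rule finite_subset[OF _ finite_zorder_nonzero[of "r + 1"]]) auto
  have ne: "?U \<noteq> {}" using r by auto
  have S_iff: "zorder w z \<noteq> 0 \<longleftrightarrow> z \<in> S" if "z \<in> ?U" for z using that by (simp add: S_def)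
  obtain g where g: "g holomorphic_on ?U"
    "\<forall>\<^sub>\<approx>z\<in>?U. w z = (\<Prod>s\<in>S. (z - s) powi zorder w s) * exp (g z)"
    "\<And>z. z \<in> ?U \<Longrightarrow> z \<notin> sing \<Longrightarrow> w z = (\<Prod>s\<in>S. (z - s) powi zorder w s) * exp (g z)"
    by (rule factorization[OF open_ball convex_ball ne finS S_iff]) blast+
  have S_good: "norm s \<noteq> r" if "s \<in> S" for s
    using that good zorder_nonzero_imp_sing by (auto simp: S_def)
  define P where "P = (\<lambda>z. \<Prod>s\<in>S - {0}. (z - s) powi zorder w s)"
  have contg: "g \<midarrow>0\<rightarrow> g 0"
    using holomorphic_on_imp_continuous_on[OF g(1)] r
    by (simp add: continuous_on_eq_continuous_at isContD)
  have "(\<lambda>z. P z * exp (g z)) \<midarrow>0\<rightarrow> P 0 * exp (g 0)"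
    unfolding P_def by (intro tendsto_intros tendsto_power_int contg) auto
  moreover have "eventually (\<lambda>z. w z * z powi (- zorder w 0) = P z * exp (g z)) (at 0)"
  proof -
    have "eventually (\<lambda>z. w z = (\<Prod>s\<in>S. (z - s) powi zorder w s) * exp (g z)) (at 0)"
      using eventually_cosparse_imp_eventually_at[OF g(2), of 0 UNIV] r by simp
    moreover have "eventually (\<lambda>z::complex. z \<noteq> 0) (at 0)" by (simp add: eventually_at_filter)
    ultimately show ?thesis
    proof eventually_elim
      case (elim z)
      have z: "z powi zorder w 0 \<noteq> 0" using elim(2) by simp
      have "(\<Prod>s\<in>S. (z - s) powi zorder w s) = z powi zorder w 0 * P z"
      proof (cases "0 \<in> S")
        case True
        then show ?thesis using finS by (simp add: P_def prod.remove[of S 0])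
      next
        case False
        then have "zorder w 0 = 0" using r by (simp add: S_def)
        then show ?thesis using False by (simp add: P_def)
      qed
      then show ?case using z elim by (simp add: power_int_minus field_simps)
    qed
  qed
  ultimately have lim: "(\<lambda>z. w z * z powi (- zorder w 0)) \<midarrow>0\<rightarrow> P 0 * exp (g 0)"
    by (subst tendsto_cong)
  have L: "L = P 0 * exp (g 0)"
    unfolding L_def
  proof (rule the_equality)
    show "(\<lambda>z. w z * z powi (- zorder w 0)) \<midarrow>0\<rightarrow> P 0 * exp (g 0)" by (rule lim)
    fix c assume "(\<lambda>z. w z * z powi (- zorder w 0)) \<midarrow>0\<rightarrow> c"
    then show "c = P 0 * exp (g 0)" using lim by (rule LIM_unique)
  qed
  have "norm L = norm (P 0) * exp (Re (g 0))" by (simp add: L norm_mult)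
  moreover have "norm (P 0) > 0" using finS by (auto simp: P_def)
  ultimately have "ln (norm L) = ln (norm (P 0)) + Re (g 0)" by (simp add: ln_mult)
  also have "ln (norm (P 0)) = (\<Sum>s\<in>S - {0}. of_int (zorder w s) * ln (norm (0 - s)))"
    unfolding P_def by (rule ln_norm_prod_powi) (use finS in auto)
  finally have lnL: "ln (norm L) = (\<Sum>s\<in>S - {0}. of_int (zorder w s) * ln (norm s)) + Re (g 0)" by simp
  have "((\<lambda>\<theta>. (\<Sum>s\<in>S. of_int (zorder w s) * ln (norm (of_real r * cis \<theta> - s))) + Re (g (of_real r * cis \<theta>)))
     has_integral (\<Sum>s\<in>S. of_int (zorder w s) * (2 * pi * ln (max r (norm s)))) + Re (2 * pi * g 0)) {0..2 * pi}"
    by (intro has_integral_add has_integral_sum has_integral_mult_right has_integral_ln_dist_circle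
        has_integral_Re has_integral_mean_value finS r holomorphic_on_subset[OF g(1)])
      (use r S_good in auto)
  then have int: "((\<lambda>\<theta>. ln (norm (w (of_real r * cis \<theta>)))) has_integral
     (\<Sum>s\<in>S. of_int (zorder w s) * (2 * pi * ln (max r (norm s)))) + Re (2 * pi * g 0)) {0..2 * pi}"
  proof (rule has_integral_eq[rotated])
    fix \<theta> :: real
    let ?z = "of_real r * cis \<theta>"
    have nrm: "norm ?z = r" using r by (simp add: norm_mult)
    have zS: "?z \<noteq> s" if "s \<in> S" for s using S_good[OF that] nrm by auto
    have w: "w ?z = (\<Prod>s\<in>S. (?z - s) powi zorder w s) * exp (g ?z)"
      using g(3)[of ?z] good[OF nrm] nrm by simp
    have "norm (\<Prod>s\<in>S. (?z - s) powi zorder w s) > 0" using zS finS by auto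
    then have "ln (norm (w ?z)) = ln (norm (\<Prod>s\<in>S. (?z - s) powi zorder w s)) + Re (g ?z)"
      unfolding w by (simp add: norm_mult ln_mult)
    then show "(\<Sum>s\<in>S. of_int (zorder w s) * ln (norm (?z - s))) + Re (g ?z) = ln (norm (w ?z))"
      using ln_norm_prod_powi[OF finS zS, of "zorder w"] by simp
  qed
  \<comment> \<open>Points of \<open>S\<close> on or outside the circle have ln (max r (norm s)) =
    ln (norm s) and drop out, so the sum may run over all of \<open>S\<close>.\<close>
  have ic: "integrated_count (disc_count \<mu>) r = (\<Sum>s\<in>S - {0}. real (\<mu> s) * (ln (max r (norm s)) - ln (norm s))) + real (\<mu> 0) * ln r"
    if mu: "locally_finite_support \<mu>" "\<And>s. zorder w s = 0 \<Longrightarrow> \<mu> s = 0" for \<mu>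
  proof -
    have "(\<Sum>s\<in>{s. norm s \<le> r \<and> \<mu> s \<noteq> 0} - {0}. real (\<mu> s) * ln (r / norm s)) =
        (\<Sum>s\<in>S - {0}. real (\<mu> s) * (ln (max r (norm s)) - ln (norm s)))"
    proof (rule sum.mono_neutral_cong_left)
      show "finite (S - {0})" using finS by simp
      show "{s. norm s \<le> r \<and> \<mu> s \<noteq> 0} - {0} \<subseteq> S - {0}"
        using mu(2) by (force simp: S_def)
      show "\<forall>s\<in>S - {0} - ({s. norm s \<le> r \<and> \<mu> s \<noteq> 0} - {0}). real (\<mu> s) * (ln (max r (norm s)) - ln (norm s)) = 0"
        by auto
      show "real (\<mu> s) * ln (r / norm s) = real (\<mu> s) * (ln (max r (norm s)) - ln (norm s))"
        if "s \<in> {s. norm s \<le> r \<and> \<mu> s \<noteq> 0} - {0}" for s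
        using that r by (simp add: ln_div max_def)
    qed
    then show ?thesis using integrated_count_eq_sum[OF mu(1) r] by simp
  qed
  \<comment> \<open>Truncation by \<open>nat\<close> makes at least one of the two multiplicities
    zero.\<close>
  have z_eq: "real_of_int (zorder w s) = real (zero_mult s) - real (pole_mult s)" for s by simp
  have icz: "integrated_count (disc_count zero_mult) r =
    (\<Sum>s\<in>S - {0}. real (zero_mult s) * (ln (max r (norm s)) - ln (norm s))) + real (zero_mult 0) * ln r"
    by (rule ic[OF locally_finite(1)]) simp
  have icp: "integrated_count (disc_count pole_mult) r =
    (\<Sum>s\<in>S - {0}. real (pole_mult s) * (ln (max r (norm s)) - ln (norm s))) + real (pole_mult 0) * ln r"
    by (rule ic[OF locally_finite(2)]) simp
  have "integrated_count (disc_count zero_mult) r - integrated_count (disc_count pole_mult) r =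
    (\<Sum>s\<in>S - {0}. of_int (zorder w s) * (ln (max r (norm s)) - ln (norm s))) + of_int (zorder w 0) * ln r"
    unfolding icz icp z_eq left_diff_distrib sum_subtractf by simp
  moreover have "(\<Sum>s\<in>S. of_int (zorder w s) * ln (max r (norm s))) =
      (\<Sum>s\<in>S - {0}. of_int (zorder w s) * ln (max r (norm s))) + of_int (zorder w 0) * ln r"
  proof (cases "0 \<in> S")
    case True
    then show ?thesis using finS r by (simp add: sum.remove[of S 0])
  next
    case False
    then have "zorder w 0 = 0" using r by (simp add: S_def)
    then show ?thesis using False by simp
  qed
  ultimately have "(\<Sum>s\<in>S. of_int (zorder w s) * ln (max r (norm s))) + Re (g 0) =
      ln (norm L) + integrated_count (disc_count zero_mult) r - integrated_count (disc_count pole_mult) r"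
    by (simp add: lnL right_diff_distrib sum_subtractf)
  moreover have "(\<Sum>s\<in>S. of_int (zorder w s) * (2 * pi * ln (max r (norm s)))) + Re (2 * pi * g 0) =
      2 * pi * ((\<Sum>s\<in>S. of_int (zorder w s) * ln (max r (norm s))) + Re (g 0))"
    by (simp add: distrib_left sum_distrib_left mult_ac)
  ultimately show "((\<lambda>\<theta>. ln (norm (w (of_real r * cis \<theta>)))) has_integral
      2 * pi * (ln (norm (THE c. (\<lambda>z. w z * z powi (- zorder w 0)) \<midarrow>0\<rightarrow> c)) +
       integrated_count (disc_count zero_mult) r - integrated_count (disc_count pole_mult) r)) {0..2 * pi}"
    using int unfolding L_def[symmetric] by simp
qed

text \<open>In Jensen's formula the mean of ln |w| is at most the proximity function, because ln
  \<le> \<open>log_plus\<close>. This is one half of the first main theorem, up to a bounded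
  term.\<close>

lemma zeros_le_characteristic:
  obtains C where "\<And>r. 0 < r \<Longrightarrow> (\<And>z. norm z = r \<Longrightarrow> z \<notin> sing) \<Longrightarrow>
    integrated_count (disc_count zero_mult) r \<le> nevanlinna_T r w + C"
proof -
  obtain C where C: "\<And>r. 0 < r \<Longrightarrow> (\<And>z. norm z = r \<Longrightarrow> z \<notin> sing) \<Longrightarrow>
    ((\<lambda>\<theta>. ln (norm (w (of_real r * cis \<theta>)))) has_integral
      2 * pi * (C + integrated_count (disc_count zero_mult) r - integrated_count (disc_count pole_mult) r)) {0..2 * pi}"
    by (rule jensen_formula) blast
  show thesis
  proof (rule that[of "- C"])
    fix r :: real
    assume r: "0 < r" and good: "\<And>z. norm z = r \<Longrightarrow> z \<notin> sing"
    have "2 * pi * (C + integrated_count (disc_count zero_mult) r - integrated_count (disc_count pole_mult) r)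
        \<le> 2 * pi * proximity_fun r w"
    proof (rule has_integral_le[OF C[OF r good] log_plus_has_integral])
      fix \<theta> :: real
      have "of_real r * cis \<theta> \<notin> sing" using good r by (simp add: norm_mult)
      then have "norm (w (of_real r * cis \<theta>)) > 0" by (auto simp: sing_def)
      then show "ln (norm (w (of_real r * cis \<theta>))) \<le> log_plus (norm (w (of_real r * cis \<theta>)))"
        by (simp add: log_plus_norm_eq)
    qed (use r good in auto)
    then show "integrated_count (disc_count zero_mult) r \<le> nevanlinna_T r w + - C"
      by (simp add: nevanlinna_T_def nevanlinna_N_eq)
  qed
qed

end

section \<open>Slow growth and rationality\<close>

lemma eventually_ln_less:
  fixes c \<alpha> \<beta> :: real
  assumes "c > 0"
  shows "eventually (\<lambda>r. \<alpha> * ln r + \<beta> < c * r) at_top"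
proof -
  have "((\<lambda>r. (\<alpha> * ln r + \<beta>) / r) \<longlongrightarrow> 0) at_top" by real_asymp
  then have "eventually (\<lambda>r. (\<alpha> * ln r + \<beta>) / r < c) at_top"
    by (rule order_tendstoD) (rule assms)
  then show ?thesis using eventually_gt_at_top[of 0]
    by eventually_elim (simp add: field_simps)
qed

text \<open>Pairing \<open>2 Re g = g + cnj g\<close> with \<open>cnj (cis \<theta> ^ n)\<close> kills the contribution of \<open>cnj g\<close>.\<close>

lemma taylor_coefficient_bound:
  assumes g: "g holomorphic_on UNIV" and r: "0 < r" and n: "0 < n"
    and B: "((\<lambda>\<theta>. \<bar>Re (g (of_real r * cis \<theta>))\<bar>) has_integral B) {0..2 * pi}"
  shows "2 * pi * norm ((deriv ^^ n) g 0) / fact n * r ^ n \<le> 2 * B"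
proof -
  let ?c = "\<lambda>\<theta>. of_real r * cis \<theta>"
  let ?d = "(deriv ^^ n) g 0"
  have holg: "g holomorphic_on A" for A using g by (rule holomorphic_on_subset) simp
  have "((\<lambda>u. g u / (u - 0) ^ Suc n) has_contour_integral (2 * pi * \<i> / fact n * ?d)) (circlepath 0 r)"
    using r by (intro Cauchy_has_contour_integral_higher_derivative_circlepath
        holomorphic_on_imp_continuous_on holg) auto
  then have "((\<lambda>t. g (0 + r * cis t) / (0 + r * cis t - 0) ^ Suc n * r * \<i> * cis t) has_integral (2 * pi * \<i> / fact n * ?d)) {0..2 * pi}"
    unfolding circlepath_def by (subst (asm) has_contour_integral_part_circlepath_iff) auto
  then have "((\<lambda>t. (- \<i> * of_real r ^ n) * (g (0 + r * cis t) / (0 + r * cis t - 0) ^ Suc n * r * \<i> * cis t))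
      has_integral ((- \<i> * of_real r ^ n) * (2 * pi * \<i> / fact n * ?d))) {0..2 * pi}"
    by (rule has_integral_mult_right)
  \<comment> \<open>Cauchy's formula for the n-th derivative, read as the n-th Fourier coefficient
    of g on the circle.\<close>
  then have 1: "((\<lambda>t. g (?c t) * cnj (cis t ^ n)) has_integral ((- \<i> * of_real r ^ n) * (2 * pi * \<i> / fact n * ?d))) {0..2 * pi}"
  proof (rule has_integral_eq[rotated])
    fix t :: real
    have "cis t * cis (- t) = 1" by (simp add: cis_mult)
    then have inv: "inverse (cis t) = cis (- t)" by (simp add: inverse_unique)
    have "(- \<i> * of_real r ^ n) * (g (0 + r * cis t) / (0 + r * cis t - 0) ^ Suc n * r * \<i> * cis t)
        = g (?c t) * (inverse (cis t)) ^ n"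
      using r by (simp add: field_simps power_mult_distrib)
    then show "(- \<i> * of_real r ^ n) * (g (0 + r * cis t) / (0 + r * cis t - 0) ^ Suc n * r * \<i> * cis t)
        = g (?c t) * cnj (cis t ^ n)" by (simp only: inv complex_cnj_power cis_cnj)
  qed
  \<comment> \<open>The mean of g(z) z^n is its value at 0, which vanishes because n > 0.\<close>
  have "((\<lambda>t. g (?c t) * (?c t) ^ n) has_integral (2 * pi * (g 0 * 0 ^ n))) {0..2 * pi}"
    by (rule has_integral_mean_value) (auto intro!: holomorphic_intros holg r)
  then have scaled: "((\<lambda>t. inverse (of_real r ^ n) * (g (?c t) * (?c t) ^ n)) has_integral (inverse (of_real r ^ n) * (2 * pi * (g 0 * 0 ^ n)))) {0..2 * pi}"
    by (rule has_integral_mult_right)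
  have e1: "inverse (of_real r ^ n) * (g (?c t) * (?c t) ^ n) = g (?c t) * cis t ^ n" for t
    using r by (simp add: power_mult_distrib field_simps)
  have e2: "inverse (of_real r ^ n) * (2 * pi * (g 0 * 0 ^ n)) = 0" using n by simp
  have "(cnj \<circ> (\<lambda>t. g (?c t) * cis t ^ n) has_integral cnj 0) {0..2 * pi}"
    unfolding has_integral_cnj using scaled unfolding e1 e2 .
  then have 2: "((\<lambda>t. cnj (g (?c t) * cis t ^ n)) has_integral cnj 0) {0..2 * pi}"
    unfolding o_def .
  have "((\<lambda>t. g (?c t) * cnj (cis t ^ n) + cnj (g (?c t) * cis t ^ n)) has_integral
      ((- \<i> * of_real r ^ n) * (2 * pi * \<i> / fact n * ?d) + cnj 0)) {0..2 * pi}"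
    by (rule has_integral_add[OF 1 2])
  moreover have "g (?c t) * cnj (cis t ^ n) + cnj (g (?c t) * cis t ^ n) =
      of_real (2 * Re (g (?c t))) * cnj (cis t ^ n)" for t
    unfolding complex_cnj_mult by (simp only: distrib_right[symmetric] complex_add_cnj)
  moreover have "(- \<i> * of_real r ^ n) * (2 * pi * \<i> / fact n * ?d) + cnj 0 = of_real r ^ n * (of_real (2 * pi) / fact n * ?d)"
  proof -
    have "(- \<i> * x) * (p * \<i> / q * d) + 0 = x * (p / q * d)" for x p q d :: complex
    proof -
      have "(- \<i> * x) * (p * \<i> / q * d) = - (\<i> * \<i>) * (x * (p / q * d))"
        by (simp only: divide_inverse mult_minus_left mult_minus_right mult_ac)
      then show ?thesis by simp
    qed
    then show ?thesis by (simp only: complex_cnj_zero)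
  qed
  ultimately have 3: "((\<lambda>t. of_real (2 * Re (g (?c t))) * cnj (cis t ^ n)) has_integral
      of_real r ^ n * (of_real (2 * pi) / fact n * ?d)) {0..2 * pi}" by simp
  have "norm (integral {0..2 * pi} (\<lambda>t. of_real (2 * Re (g (?c t))) * cnj (cis t ^ n)))
      \<le> integral {0..2 * pi} (\<lambda>t. 2 * \<bar>Re (g (?c t))\<bar>)"
  proof (rule integral_norm_bound_integral)
    show "(\<lambda>t. of_real (2 * Re (g (?c t))) * cnj (cis t ^ n)) integrable_on {0..2 * pi}"
      using 3 by (rule has_integral_integrable)
    show "(\<lambda>t. 2 * \<bar>Re (g (?c t))\<bar>) integrable_on {0..2 * pi}"
      using has_integral_mult_right[OF B, of 2] by (rule has_integral_integrable)
    show "norm (of_real (2 * Re (g (?c t))) * cnj (cis t ^ n)) \<le> 2 * \<bar>Re (g (?c t))\<bar>" for t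
      by (simp add: norm_mult norm_power del: of_real_mult complex_cnj_power)
  qed
  then have "norm (of_real r ^ n * (of_real (2 * pi) / fact n * ?d)) \<le> 2 * B"
    unfolding integral_unique[OF 3] integral_unique[OF has_integral_mult_right[OF B, of 2]] .
  then show ?thesis using r by (simp add: norm_mult norm_divide norm_power mult_ac)
qed

context nonzero_mero begin

text \<open>With finitely many zeros and poles, \<open>w\<close> is a rational function times exp g
  with g entire. The hypothesis bounds Re g from above, the mean value of Re g turns this into a
  logarithmic bound for the integral of |Re g| along arbitrarily large radii, and so g is
  constant.\<close>

lemma rational_if_slow_growth:
  assumes fin: "finite {z. zorder w z \<noteq> 0}"
    and slow: "\<And>R. \<exists>r\<ge>R. (\<forall>z. norm z = r \<longrightarrow> z \<notin> sing) \<and> proximity_fun r w \<le> C * ln r"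
  shows "rational_function w"
proof -
  define S where "S = {z. zorder w z \<noteq> 0}"
  have finS: "finite S" using fin by (simp add: S_def)
  obtain g where g: "g holomorphic_on UNIV"
    "\<forall>\<^sub>\<approx>z. w z = (\<Prod>s\<in>S. (z - s) powi zorder w s) * exp (g z)"
    "\<And>z. z \<in> UNIV \<Longrightarrow> z \<notin> sing \<Longrightarrow> w z = (\<Prod>s\<in>S. (z - s) powi zorder w s) * exp (g z)"
    by (rule factorization[OF open_UNIV convex_UNIV UNIV_not_empty finS]) (simp_all add: S_def)
  obtain M where M: "M \<ge> 0" "\<And>s. s \<in> S \<Longrightarrow> norm s \<le> M"
    using finite_imp_bounded[OF finS] unfolding bounded_iff by (metis norm_ge_zero order.trans linear)
  define K where "K = (\<Sum>s\<in>S. real_of_int \<bar>zorder w s\<bar>)"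
  \<comment> \<open>Twice the integral of the upper bound for Re g, minus the integral of Re g
    itself, which is 2 pi Re (g 0).\<close>
  define B where "B = (\<lambda>r. 2 * (2 * pi * (C * ln r) + 2 * pi * (K * ln (2 * r))) - 2 * pi * Re (g 0))"
  have K0: "K \<ge> 0" by (simp add: K_def sum_nonneg)
  have coeff: "2 * pi * norm ((deriv ^^ n) g 0) / fact n * r ^ n \<le> 2 * B r"
    if r: "r \<ge> M + 1" and good: "\<forall>z. norm z = r \<longrightarrow> z \<notin> sing" and prox: "proximity_fun r w \<le> C * ln r"
      and n: "0 < n" for r n
  proof -
    let ?z = "\<lambda>\<theta>. of_real r * cis \<theta>"
    have r1: "r \<ge> 1" using r M(1) by simp
    have nz: "norm (?z \<theta>) = r" for \<theta> using r1 by (simp add: norm_mult)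
    have Re_le: "Re (g (?z \<theta>)) \<le> log_plus (norm (w (?z \<theta>))) + K * ln (2 * r)" for \<theta>
    proof -
      \<comment> \<open>The choice r \<ge> M + 1 puts every ln (norm (z - s)) between 0 and ln (2
        r), so that zeros and poles are estimated alike.\<close>
      have ge1: "1 \<le> norm (?z \<theta> - s) \<and> norm (?z \<theta> - s) \<le> 2 * r" if "s \<in> S" for s
        using norm_triangle_ineq2[of "?z \<theta>" s] norm_triangle_ineq4[of "?z \<theta>" s] M(2)[OF that] r M(1)
        unfolding nz by simp
      have zS: "?z \<theta> \<noteq> s" if "s \<in> S" for s using ge1[OF that] by auto
      have ns: "?z \<theta> \<notin> sing" using good nz by blast
      then have wpos: "norm (w (?z \<theta>)) > 0" by (auto simp: sing_def)
      have "norm (\<Prod>s\<in>S. (?z \<theta> - s) powi zorder w s) > 0" using zS finS by auto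
      then have "ln (norm (w (?z \<theta>))) = ln (norm (\<Prod>s\<in>S. (?z \<theta> - s) powi zorder w s)) + Re (g (?z \<theta>))"
        unfolding g(3)[OF UNIV_I ns] by (simp add: norm_mult ln_mult)
      then have "Re (g (?z \<theta>)) = ln (norm (w (?z \<theta>))) + (\<Sum>s\<in>S. - (of_int (zorder w s) * ln (norm (?z \<theta> - s))))"
        using ln_norm_prod_powi[OF finS zS, of "zorder w"] by (simp add: sum_negf)
      also have "(\<Sum>s\<in>S. - (of_int (zorder w s) * ln (norm (?z \<theta> - s)))) \<le> (\<Sum>s\<in>S. of_int \<bar>zorder w s\<bar> * ln (2 * r))"
      proof (rule sum_mono)
        fix s assume s: "s \<in> S"
        have l: "0 \<le> ln (norm (?z \<theta> - s))" "ln (norm (?z \<theta> - s)) \<le> ln (2 * r)"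
          using ge1[OF s] r1 by (auto simp: ln_le_cancel_iff[OF order.strict_trans2[OF zero_less_one]])
        have "- (of_int (zorder w s) * ln (norm (?z \<theta> - s))) \<le> of_int \<bar>zorder w s\<bar> * ln (norm (?z \<theta> - s))"
          using l(1) mult_right_mono[of "- real_of_int (zorder w s)" "of_int \<bar>zorder w s\<bar>"] by simp
        also have "\<dots> \<le> of_int \<bar>zorder w s\<bar> * ln (2 * r)" using l by (intro mult_left_mono) auto
        finally show "- (of_int (zorder w s) * ln (norm (?z \<theta> - s))) \<le> of_int \<bar>zorder w s\<bar> * ln (2 * r)" .
      qed
      also have "\<dots> = K * ln (2 * r)" by (simp add: K_def sum_distrib_right)
      also have "ln (norm (w (?z \<theta>))) \<le> log_plus (norm (w (?z \<theta>)))"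
        using wpos by (simp add: log_plus_norm_eq)
      finally show ?thesis by simp
    qed
    have ReI: "((\<lambda>\<theta>. Re (g (?z \<theta>))) has_integral Re (2 * pi * g 0)) {0..2 * pi}"
      using r1 by (intro has_integral_Re has_integral_mean_value holomorphic_on_subset[OF g(1)]) auto
    have contRe: "continuous_on {0..2 * pi} (\<lambda>\<theta>. Re (g (?z \<theta>)))"
      by (intro continuous_on_Re continuous_on_compose2[OF holomorphic_on_imp_continuous_on[OF g(1)]]
          continuous_intros) auto
    define I where "I = integral {0..2 * pi} (\<lambda>\<theta>. \<bar>Re (g (?z \<theta>))\<bar>)"
    have I: "((\<lambda>\<theta>. \<bar>Re (g (?z \<theta>))\<bar>) has_integral I) {0..2 * pi}" unfolding I_def
      by (intro integrable_integral integrable_continuous_interval continuous_on_rabs contRe)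
    have lp: "((\<lambda>\<theta>. log_plus (norm (w (?z \<theta>)))) has_integral (2 * pi * proximity_fun r w)) {0..2 * pi}"
      using good r1 by (intro log_plus_has_integral) auto
    have const: "((\<lambda>\<theta>::real. K * ln (2 * r)) has_integral (2 * pi * (K * ln (2 * r)))) {0..2 * pi}"
      using has_integral_const_real[of "K * ln (2 * r)" 0 "2 * pi"] by simp
    \<comment> \<open>If x \<le> u and u \<ge> 0, then |x| \<le> 2 u - x; apply this with x = Re
      g.\<close>
    have "I \<le> 2 * (2 * pi * proximity_fun r w + 2 * pi * (K * ln (2 * r))) - Re (2 * pi * g 0)"
    proof (rule has_integral_le[OF I])
      show "((\<lambda>\<theta>. 2 * (log_plus (norm (w (?z \<theta>))) + K * ln (2 * r)) - Re (g (?z \<theta>))) has_integral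
          (2 * (2 * pi * proximity_fun r w + 2 * pi * (K * ln (2 * r))) - Re (2 * pi * g 0))) {0..2 * pi}"
        by (intro has_integral_diff has_integral_mult_right has_integral_add lp const ReI)
      fix \<theta>
      have "0 \<le> log_plus (norm (w (?z \<theta>)))" by (simp add: log_plus_def)
      moreover have "0 \<le> K * ln (2 * r)" using K0 r1 by simp
      moreover have "\<bar>x\<bar> \<le> 2 * (l + k) - x" if "0 \<le> l" "0 \<le> k" "x \<le> l + k" for x l k :: real
        using that by (auto simp: abs_le_iff)
      ultimately show "\<bar>Re (g (?z \<theta>))\<bar> \<le> 2 * (log_plus (norm (w (?z \<theta>))) + K * ln (2 * r)) - Re (g (?z \<theta>))"
        using Re_le[of \<theta>] by blast
    qed
    also have "\<dots> \<le> B r" using mult_left_mono[OF prox, of "2 * pi"] by (simp add: B_def)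
    finally have "I \<le> B r" .
    moreover have "2 * pi * norm ((deriv ^^ n) g 0) / fact n * r ^ n \<le> 2 * I"
      using r1 by (intro taylor_coefficient_bound g(1) n I) simp
    ultimately show ?thesis by linarith
  qed
  have deriv0: "(deriv ^^ n) g 0 = 0" if n: "0 < n" for n
  proof (rule ccontr)
    assume "(deriv ^^ n) g 0 \<noteq> 0"
    then have c: "2 * pi * norm ((deriv ^^ n) g 0) / fact n > 0" (is "?c > 0") by simp
    have "eventually (\<lambda>r. (8 * pi * (C + K)) * ln r + (8 * pi * K * ln 2 - 4 * pi * Re (g 0)) < ?c * r) at_top"
      by (rule eventually_ln_less) (rule c)
    then obtain R where R: "\<And>r. r \<ge> R \<Longrightarrow> (8 * pi * (C + K)) * ln r + (8 * pi * K * ln 2 - 4 * pi * Re (g 0)) < ?c * r"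
      unfolding eventually_at_top_linorder by blast
    obtain r where r: "r \<ge> max R (M + 1)" "\<forall>z. norm z = r \<longrightarrow> z \<notin> sing" "proximity_fun r w \<le> C * ln r"
      using slow by blast
    have r1: "r \<ge> 1" using r(1) M(1) by simp
    \<comment> \<open>A nonzero coefficient of positive order forces at least linear growth, against
      the logarithmic bound.\<close>
    have "?c * r \<le> ?c * r ^ n" using c r1 n by (intro mult_left_mono self_le_power) auto
    also have "\<dots> \<le> 2 * B r" using r n by (intro coeff) auto
    also have "\<dots> = (8 * pi * (C + K)) * ln r + (8 * pi * K * ln 2 - 4 * pi * Re (g 0))"
      using r1 by (simp add: B_def ln_mult algebra_simps)
    finally show False using R[of r] r(1) by simp
  qed
  have gconst: "g z = g 0" for z
    using holomorphic_fun_eq_const_on_connected[OF g(1) open_UNIV connected_UNIV deriv0] by simp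
  define p where "p = smult (exp (g 0)) (\<Prod>s\<in>S. [:- s, 1:] ^ zero_mult s)"
  define q where "q = (\<Prod>s\<in>S. [:- s, 1:] ^ pole_mult s)"
  have q: "q \<noteq> 0" using finS by (auto simp: q_def)
  have pq: "(\<Prod>s\<in>S. (z - s) powi zorder w s) * exp (g z) = poly p z / poly q z" for z
  proof -
    have "(z - s) powi zorder w s = (z - s) ^ zero_mult s / (z - s) ^ pole_mult s" for s
      by (auto simp: power_int_def field_simps)
    then show ?thesis by (simp add: p_def q_def poly_prod gconst[of z] prod_dividef)
  qed
  show ?thesis unfolding rational_function_def using g(2) q by (auto simp: pq)
qed

end

section \<open>The delay differential equation\<close>

lemma filterlim_shift_at_infinity:
  "filterlim (\<lambda>z :: complex. z + c) at_infinity at_infinity"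
  by (intro tendsto_add_filterlim_at_infinity'[OF filterlim_ident tendsto_const])

lemma eventually_shift_at_infinity:
  assumes "eventually P (at_infinity :: complex filter)"
  shows "eventually (\<lambda>z. P (z + c)) at_infinity"
  using filterlim_shift_at_infinity assms unfolding filterlim_iff by blast

lemma eventually_poly_nz_at_infinity:
  assumes "p \<noteq> (0 :: complex poly)"
  shows "eventually (\<lambda>z. poly p z \<noteq> 0) at_infinity"
proof -
  have "bounded {z. poly p z = 0}" using poly_roots_finite[OF assms] by (rule finite_imp_bounded)
  then obtain B where "\<And>z. poly p z = 0 \<Longrightarrow> norm z \<le> B" unfolding bounded_iff by auto
  then show ?thesis unfolding eventually_at_infinity
    by (metis add_increasing2 linorder_not_le less_add_one order.strict_trans1)
qed

text \<open>Compare numerator and denominator with (z + c)^n and z^n; the quotient of these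
  monomials tends to 1.\<close>

lemma poly_shift_ratio_tendsto:
  assumes "p \<noteq> (0 :: complex poly)"
  shows "((\<lambda>z. poly p (z + c) / poly p z) \<longlongrightarrow> 1) at_infinity"
proof -
  let ?n = "degree p"
  have l: "lead_coeff p \<noteq> 0" using assms by simp
  note 1 = poly_divide_tendsto_aux[of p]
  have 2: "((\<lambda>z. poly p (z + c) / (z + c) ^ ?n) \<longlongrightarrow> lead_coeff p) at_infinity"
    using filterlim_compose[OF 1 filterlim_shift_at_infinity] .
  have "((\<lambda>z::complex. 1 + c / z) \<longlongrightarrow> 1 + 0) at_infinity"
    by (intro tendsto_add tendsto_const tendsto_divide_0[OF tendsto_const filterlim_ident])
  then have 3: "((\<lambda>z::complex. (1 + c / z) ^ ?n) \<longlongrightarrow> 1) at_infinity"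
    using tendsto_power[of "\<lambda>z. 1 + c / z" "1 + 0" at_infinity ?n] by simp
  have "((\<lambda>z. (poly p (z + c) / (z + c) ^ ?n) * (1 + c / z) ^ ?n / (poly p z / z ^ ?n))
      \<longlongrightarrow> lead_coeff p * 1 / lead_coeff p) at_infinity"
    by (intro tendsto_divide tendsto_mult 1 2 3 l)
  then have lim: "((\<lambda>z. (poly p (z + c) / (z + c) ^ ?n) * (1 + c / z) ^ ?n / (poly p z / z ^ ?n))
      \<longlongrightarrow> 1) at_infinity" using l by simp
  have "eventually (\<lambda>z::complex. poly [:0, 1:] z \<noteq> 0) at_infinity"
    by (rule eventually_poly_nz_at_infinity) simp
  moreover have "eventually (\<lambda>z::complex. poly [:c, 1:] z \<noteq> 0) at_infinity"
    by (rule eventually_poly_nz_at_infinity) simp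
  ultimately have "eventually (\<lambda>z. (poly p (z + c) / (z + c) ^ ?n) * (1 + c / z) ^ ?n / (poly p z / z ^ ?n)
      = poly p (z + c) / poly p z) at_infinity"
  proof eventually_elim
    case (elim z)
    then have "z \<noteq> 0" "z + c \<noteq> 0" by (auto simp: add.commute)
    have "(1 + c / z) ^ ?n = (z + c) ^ ?n / z ^ ?n"
      using \<open>z \<noteq> 0\<close> by (simp add: field_simps flip: power_divide)
    then show ?case using \<open>z \<noteq> 0\<close> \<open>z + c \<noteq> 0\<close> by simp
  qed
  then show ?thesis using lim tendsto_cong by fastforce
qed

abbreviation polyquot :: "complex poly \<Rightarrow> complex poly \<Rightarrow> complex \<Rightarrow> complex" where
  "polyquot p q z \<equiv> poly p z / poly q z"

lemma polyquot_shift_ratio_tendsto: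
  assumes "p \<noteq> 0" "q \<noteq> 0"
  shows "((\<lambda>z. polyquot p q (z + c) / polyquot p q z) \<longlongrightarrow> 1) at_infinity"
proof -
  have "((\<lambda>z. (poly p (z + c) / poly p z) / (poly q (z + c) / poly q z)) \<longlongrightarrow> 1 / 1) at_infinity"
    by (intro tendsto_divide poly_shift_ratio_tendsto assms) simp
  then show ?thesis by (simp add: field_simps)
qed

text \<open>Cross-multiplication turns equality into the vanishing of a polynomial \<open>h\<close>.
  If \<open>h\<close> were 0, the quotient would keep one value k along an arithmetic progression,
  and p - k q would have infinitely many zeros.\<close>

lemma polyquot_shift_neq:
  assumes "q \<noteq> 0" "\<And>k. p \<noteq> smult k q" "c \<noteq> 0"
  shows "eventually (\<lambda>z. polyquot p q (z + c) \<noteq> polyquot p q z) at_infinity"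
proof -
  define h where "h = pcompose p [:c, 1:] * q - p * pcompose q [:c, 1:]"
  have ph: "poly h z = poly p (z + c) * poly q z - poly p z * poly q (z + c)" for z
    by (simp add: h_def poly_pcompose add.commute)
  have "h \<noteq> 0"
  proof
    assume "h = 0"
    then have eq: "poly p (z + c) * poly q z = poly p z * poly q (z + c)" for z
      using ph[of z] by simp
    have "eventually (\<lambda>z. poly q z \<noteq> 0) at_infinity"
      by (rule eventually_poly_nz_at_infinity) fact
    then obtain B where B: "\<And>z. norm z \<ge> B \<Longrightarrow> poly q z \<noteq> 0"
      unfolding eventually_at_infinity by blast
    \<comment> \<open>Starting in the direction of c makes the modulus grow along z0 + n c, so the
      progression stays clear of the zeros of \<open>q\<close>.\<close>
    define z0 where "z0 = of_real (max B 1) * sgn c"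
    have pos: "norm (z0 + of_nat n * c) \<ge> B" for n
    proof -
      have "z0 + of_nat n * c = of_real (max B 1 + n * norm c) * sgn c"
        by (simp add: z0_def algebra_simps sgn_eq assms(3))
      also have "norm \<dots> = \<bar>max B 1 + n * norm c\<bar>"
        using assms(3) by (simp only: norm_mult norm_of_real norm_sgn) simp
      also have "\<dots> \<ge> B" by (smt (verit) mult_nonneg_nonneg norm_ge_zero of_nat_0_le_iff)
      finally show ?thesis .
    qed
    define k where "k = polyquot p q z0"
    have val: "poly p (z0 + of_nat n * c) = k * poly q (z0 + of_nat n * c)" for n
    proof (induction n)
      case 0
      then show ?case using B[OF pos[of 0]] by (simp add: k_def)
    next
      case (Suc n)
      let ?z = "z0 + of_nat n * c"
      have s: "z0 + of_nat (Suc n) * c = ?z + c" by (simp add: algebra_simps)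
      have "poly q ?z \<noteq> 0" by (intro B pos)
      then show ?case using eq[of ?z] Suc unfolding s by (simp add: field_simps)
    qed
    have "infinite (range (\<lambda>n. z0 + of_nat n * c))"
      using assms(3) by (intro range_inj_infinite) (auto simp: inj_on_def)
    moreover have "range (\<lambda>n. z0 + of_nat n * c) \<subseteq> {z. poly (p - smult k q) z = 0}"
      using val by auto
    ultimately have "p - smult k q = 0"
      using poly_roots_finite finite_subset by blast
    then show False using assms(2)[of k] by simp
  qed
  then have "eventually (\<lambda>z. poly h z \<noteq> 0) at_infinity"
    by (rule eventually_poly_nz_at_infinity)
  moreover have "eventually (\<lambda>z. poly q z \<noteq> 0) at_infinity"
    by (rule eventually_poly_nz_at_infinity) fact
  moreover have "eventually (\<lambda>z. poly q (z + c) \<noteq> 0) at_infinity"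
    by (rule eventually_shift_at_infinity[OF eventually_poly_nz_at_infinity]) fact
  ultimately show ?thesis
    by eventually_elim (auto simp: ph frac_eq_eq)
qed

lemma laurent_expansion_analytic_nth:
  assumes "f analytic_on {z}"
  shows "j < 0 \<Longrightarrow> laurent_expansion f z $$ j = 0" and "laurent_expansion f z $$ 0 = f z"
proof -
  have "laurent_expansion f z = fps_to_fls (fps_expansion f z)"
    by (intro laurent_expansion_eqI has_laurent_expansion_fps analytic_at_imp_has_fps_expansion assms)
  then show "j < 0 \<Longrightarrow> laurent_expansion f z $$ j = 0" "laurent_expansion f z $$ 0 = f z"
    by (auto simp: fps_expansion_def)
qed

lemma eventually_at_shift:
  fixes c :: complex
  assumes "\<forall>\<^sub>\<approx>z. P z"
  shows "eventually (\<lambda>t. P (c + t)) (at 0)"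
proof -
  have "eventually P (at c)" using assms by (rule eventually_cosparse_imp_eventually_at) simp
  then have "eventually (\<lambda>t. P (t + c)) (at 0)" by (subst (asm) eventually_at_to_0)
  then show ?thesis by (simp only: add.commute[of _ c])
qed

lemma polyquot_analytic:
  assumes "poly q z \<noteq> 0"
  shows "polyquot p q analytic_on {z}"
proof -
  have "poly p analytic_on {z}" for p :: "complex poly"
    by (rule analytic_on_subset[of _ UNIV]) (auto simp: analytic_on_open intro!: holomorphic_intros)
  then show ?thesis using assms by (intro analytic_on_divide) auto
qed

lemma pcompose_neg_involution:
  fixes p :: "'a :: idom poly"
  shows "pcompose (pcompose p [:0, -1:]) [:0, -1:] = p"
proof -
  have "pcompose [:0, -1:] [:0, -1:] = ([:0, 1:] :: 'a poly)" by (simp add: pcompose_pCons)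
  then show ?thesis by (metis pcompose_assoc pcompose_idR)
qed

lemma pcompose_neg_eq_0_iff:
  fixes p :: "'a :: idom poly"
  shows "pcompose p [:0, -1:] = 0 \<longleftrightarrow> p = 0"
  by (metis pcompose_neg_involution pcompose_0)

lemma expansion_polyquot_nth_0: "poly q z \<noteq> 0 \<Longrightarrow> laurent_expansion (polyquot p q) z $$ 0 = polyquot p q z"
  by (intro laurent_expansion_analytic_nth(2) polyquot_analytic)

lemma expansion_polyquot_const:
  assumes "poly q z \<noteq> 0"
  shows "laurent_expansion (polyquot (smult c q) q) z = fls_const c"
proof (rule laurent_expansion_eqI)
  have "eventually (\<lambda>t. poly q (z + t) \<noteq> 0) (at 0)"
  proof (rule tendsto_imp_eventually_ne)
    show "(\<lambda>t. poly q (z + t)) \<midarrow>0\<rightarrow> poly q (z + 0)" by (intro tendsto_intros)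
  qed (use assms in simp)
  then have "eventually (\<lambda>t. polyquot (smult c q) q (z + t) = c) (at 0)"
    by eventually_elim simp
  from iffD2[OF has_laurent_expansion_cong[OF this refl] has_laurent_expansion_const]
  show "(\<lambda>t. polyquot (smult c q) q (z + t)) has_laurent_expansion fls_const c" .
qed

section \<open>The equation in Laurent series and the existence of pole runs\<close>

locale delay_eq = nonzero_mero +
  fixes pa qa pb qb :: "complex poly"
  assumes pa: "pa \<noteq> 0" and qa: "qa \<noteq> 0" and qb: "qb \<noteq> 0"
    and eq: "\<forall>\<^sub>\<approx>z. w (z + 1) - w (z - 1) + polyquot pa qa z * (deriv w z / w z) = polyquot pb qb z"
begin

text \<open>An identity off a sparse set holds on a punctured neighbourhood of every point, hence
  passes to Laurent expansions, even where \<open>w\<close> has zeros or poles.\<close>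

lemma expansion_eq:
  defines "L \<equiv> laurent_expansion"
  assumes "poly qa z \<noteq> 0" "poly qb z \<noteq> 0"
  shows "L w (z + 1) - L w (z - 1) + L (polyquot pa qa) z * (fls_deriv (L w z) / L w z)
    = L (polyquot pb qb) z"
proof -
  have a: "(\<lambda>t. polyquot pa qa (z + t)) has_laurent_expansion L (polyquot pa qa) z"
    and b: "(\<lambda>t. polyquot pb qb (z + t)) has_laurent_expansion L (polyquot pb qb) z"
    unfolding L_def
    using meromorphic_on_imp_has_laurent_expansion[OF analytic_on_imp_meromorphic_on[OF polyquot_analytic]]
      assms by blast+
  have d: "(\<lambda>t. deriv w (z + t)) has_laurent_expansion fls_deriv (L w z)"
  proof -
    have "deriv (\<lambda>t. w (z + t)) has_laurent_expansion fls_deriv (L w z)"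
      unfolding L_def by (intro has_laurent_expansion_deriv w_expansion)
    moreover have "deriv (\<lambda>t. w (z + t)) = (\<lambda>t. deriv w (z + t))"
      by (simp add: fun_eq_iff deriv_def DERIV_shift add.commute[of z])
    ultimately show ?thesis by simp
  qed
  have lhs: "(\<lambda>t. w ((z + 1) + t) - w ((z - 1) + t) + polyquot pa qa (z + t) * (deriv w (z + t) / w (z + t)))
     has_laurent_expansion
      (L w (z + 1) - L w (z - 1) + L (polyquot pa qa) z * (fls_deriv (L w z) / L w z))"
    by (intro has_laurent_expansion_add has_laurent_expansion_diff has_laurent_expansion_mult
        has_laurent_expansion_divide a d) (auto simp: L_def w_expansion)
  have "eventually (\<lambda>t. w ((z + 1) + t) - w ((z - 1) + t) + polyquot pa qa (z + t) * (deriv w (z + t) / w (z + t)) = polyquot pb qb (z + t)) (at 0)"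
    using eventually_at_shift[OF eq, of z] by eventually_elim (simp add: algebra_simps)
  from iffD1[OF has_laurent_expansion_cong[OF this refl] lhs]
  have "(\<lambda>t. polyquot pb qb (z + t)) has_laurent_expansion
      (L w (z + 1) - L w (z - 1) + L (polyquot pa qa) z * (fls_deriv (L w z) / L w z))" .
  then show ?thesis using b has_laurent_expansion_unique by blast
qed

lemma delay_chain_at:
  assumes "\<And>k. \<bar>k\<bar> \<le> 5 \<Longrightarrow> poly pa (z + of_int k) \<noteq> 0 \<and> poly qa (z + of_int k) \<noteq> 0 \<and> poly qb (z + of_int k) \<noteq> 0"
  shows "delay_chain (\<lambda>k. laurent_expansion w (z + of_int k))
    (\<lambda>k. laurent_expansion (polyquot pa qa) (z + of_int k))
    (\<lambda>k. laurent_expansion (polyquot pb qb) (z + of_int k))"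
proof
  fix k j :: int
  assume k: "\<bar>k\<bar> \<le> 5"
  note nzk = assms[OF k]
  have an: "polyquot pa qa analytic_on {z + of_int k}" "polyquot pb qb analytic_on {z + of_int k}"
    by (auto intro!: polyquot_analytic simp: nzk)
  show "laurent_expansion (polyquot pa qa) (z + of_int k) $$ j = 0"
    "laurent_expansion (polyquot pb qb) (z + of_int k) $$ j = 0" if "j < 0"
    using an that by (auto intro!: laurent_expansion_analytic_nth)
  show "laurent_expansion (polyquot pa qa) (z + of_int k) $$ 0 \<noteq> 0"
    using an nzk by (simp add: laurent_expansion_analytic_nth)
  show "laurent_expansion w (z + of_int (k + 1)) - laurent_expansion w (z + of_int (k - 1)) +
    laurent_expansion (polyquot pa qa) (z + of_int k) *
      (fls_deriv (laurent_expansion w (z + of_int k)) / laurent_expansion w (z + of_int k)) =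
    laurent_expansion (polyquot pb qb) (z + of_int k)"
    using expansion_eq[of "z + of_int k"] nzk by (simp add: algebra_simps)
qed (rule expansion_nz)

lemma eventually_coeffs_nz:
  "eventually (\<lambda>z. \<forall>k\<in>{-5..5}. poly pa (z + of_int k) \<noteq> 0 \<and> poly qa (z + of_int k) \<noteq> 0 \<and>
     poly qb (z + of_int k) \<noteq> 0) at_infinity"
  by (intro eventually_ball_finite ballI eventually_conj eventually_shift_at_infinity
      eventually_poly_nz_at_infinity pa qa qb) auto

text \<open>The disjunction in the premise lists the two situations that produce a run to the right.
  Far out, a(z + 3) / a(z + 1) is close to 1, which supplies the sign condition.\<close>

lemma eventually_pole_run_right:
  assumes nonconst: "(\<forall>c. pa \<noteq> smult c qa) \<or> (\<forall>c. pb \<noteq> smult c qb)"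
  shows "eventually (\<lambda>z. zorder w z = 1 \<longrightarrow>
     zorder w (z - 1) \<ge> 0 \<or> zorder w (z + 1) < 0 \<and> zorder w (z + 3) < 0 \<longrightarrow>
     pole_run (\<lambda>k. zorder w (z + of_int k))) at_infinity"
proof -
  have "((\<lambda>z. polyquot pa qa ((z + 1) + 2) / polyquot pa qa (z + 1)) \<longlongrightarrow> 1) at_infinity"
    by (rule filterlim_compose[OF polyquot_shift_ratio_tendsto filterlim_shift_at_infinity]) (rule pa qa)+
  then have "((\<lambda>z. Re (polyquot pa qa ((z + 1) + 2) / polyquot pa qa (z + 1))) \<longlongrightarrow> Re 1) at_infinity"
    by (rule tendsto_Re)
  then have ratio: "eventually (\<lambda>z. Re (polyquot pa qa (z + 3) / polyquot pa qa (z + 1)) > 0) at_infinity"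
    using order_tendstoD(1)[of _ "Re 1" at_infinity 0] by (simp add: add.assoc)
  \<comment> \<open>A rational function that is not constant has no period. Thus a(z + 2) differs
    from a(z), or else \<open>a\<close> is constant and the values of \<open>b\<close> at z + 2 and
    z + 1 differ.\<close>
  have alt: "eventually (\<lambda>z. polyquot pa qa (z + 2) \<noteq> polyquot pa qa z \<or>
     polyquot pb qb (z + 2) \<noteq> polyquot pb qb (z + 1) \<and> (\<exists>c. pa = smult c qa)) at_infinity"
  proof (cases "\<exists>c. pa = smult c qa")
    case False
    then have "eventually (\<lambda>z. polyquot pa qa (z + 2) \<noteq> polyquot pa qa z) at_infinity"
      by (intro polyquot_shift_neq qa) auto
    then show ?thesis by eventually_elim auto
  next
    case True
    then have "eventually (\<lambda>z. polyquot pb qb (z + 1) \<noteq> polyquot pb qb z) at_infinity"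
      using nonconst by (intro polyquot_shift_neq qb) auto
    from eventually_shift_at_infinity[OF this, of 1] show ?thesis
      by eventually_elim (use True in \<open>auto simp: add.assoc\<close>)
  qed
  show ?thesis
    using ratio alt eventually_coeffs_nz
  proof eventually_elim
    case (elim z)
    let ?A = "\<lambda>k. laurent_expansion (polyquot pa qa) (z + of_int k)"
    let ?B = "\<lambda>k. laurent_expansion (polyquot pb qb) (z + of_int k)"
    have nzk: "poly pa (z + of_int k) \<noteq> 0" "poly qa (z + of_int k) \<noteq> 0" "poly qb (z + of_int k) \<noteq> 0"
      if "\<bar>k\<bar> \<le> 5" for k
    proof -
      have "k \<in> {-5..5}" using that by auto
      then show "poly pa (z + of_int k) \<noteq> 0" "poly qa (z + of_int k) \<noteq> 0" "poly qb (z + of_int k) \<noteq> 0"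
        using elim(3) by blast+
    qed
    interpret delay_chain "\<lambda>k. laurent_expansion w (z + of_int k)" ?A ?B "\<lambda>k. zorder w (z + of_int k)"
      "\<lambda>k. ?A k $$ 0" "\<lambda>k. ?B k $$ 0"
      using delay_chain_at nzk by (simp_all add: zorder_eq)
    have A0: "?A k $$ 0 = polyquot pa qa (z + of_int k)" if "\<bar>k\<bar> \<le> 5" for k
      using nzk[OF that] by (rule_tac expansion_polyquot_nth_0)
    have B0: "?B k $$ 0 = polyquot pb qb (z + of_int k)" if "\<bar>k\<bar> \<le> 5" for k
      using nzk[OF that] by (rule_tac expansion_polyquot_nth_0)
    have r: "Re (?A 3 $$ 0 / ?A 1 $$ 0) > 0"
      using elim(1) A0[of 3] A0[of 1] by simp
    have alt: "\<exists>c. ?A 2 $$ 0 \<noteq> ?A 0 $$ 0 \<or> ?B 2 $$ 0 \<noteq> ?B 1 $$ 0 \<and> (\<forall>k. \<bar>k\<bar> \<le> 5 \<longrightarrow> ?A k = fls_const c)"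
    proof -
      from elim(2) consider "polyquot pa qa (z + 2) \<noteq> polyquot pa qa z" |
        c where "polyquot pb qb (z + 2) \<noteq> polyquot pb qb (z + 1)" "pa = smult c qa" by blast
      then show ?thesis
      proof cases
        case 1
        then show ?thesis using A0[of 2] A0[of 0] by simp
      next
        case (2 c)
        then show ?thesis using B0[of 2] B0[of 1] expansion_polyquot_const nzk by (intro exI[of _ c]) simp
      qed
    qed
    show ?case
      using pole_run_if_poles_1_3 pole_run_if_regular_left alt r by auto
  qed
qed

text \<open>Regularity at both points would force a(z + 2) + a(z - 2) = a(z), but the quotient of
  the two sides tends to 2.\<close>

lemma eventually_poles_at_distance_3:
  "eventually (\<lambda>z. zorder w z = 1 \<longrightarrow> zorder w (z + 1) < 0 \<longrightarrow> zorder w (z - 1) < 0 \<longrightarrow>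
     zorder w (z + 3) < 0 \<or> zorder w (z - 3) < 0) at_infinity"
proof -
  have "((\<lambda>z. polyquot pa qa (z + 2) / polyquot pa qa z + polyquot pa qa (z + (-2)) / polyquot pa qa z)
     \<longlongrightarrow> 1 + 1) at_infinity"
    by (intro tendsto_add polyquot_shift_ratio_tendsto pa qa)
  then have "eventually (\<lambda>z. polyquot pa qa (z + 2) / polyquot pa qa z + polyquot pa qa (z + (-2)) / polyquot pa qa z \<noteq> 1) at_infinity"
    by (rule tendsto_imp_eventually_ne) simp
  then show ?thesis
    using eventually_coeffs_nz
  proof eventually_elim
    case (elim z)
    let ?A = "\<lambda>k. laurent_expansion (polyquot pa qa) (z + of_int k)"
    let ?B = "\<lambda>k. laurent_expansion (polyquot pb qb) (z + of_int k)"
    have nzk: "poly pa (z + of_int k) \<noteq> 0" "poly qa (z + of_int k) \<noteq> 0" "poly qb (z + of_int k) \<noteq> 0"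
      if "\<bar>k\<bar> \<le> 5" for k
    proof -
      have "k \<in> {-5..5}" using that by auto
      then show "poly pa (z + of_int k) \<noteq> 0" "poly qa (z + of_int k) \<noteq> 0" "poly qb (z + of_int k) \<noteq> 0"
        using elim(2) by blast+
    qed
    interpret delay_chain "\<lambda>k. laurent_expansion w (z + of_int k)" ?A ?B "\<lambda>k. zorder w (z + of_int k)"
      "\<lambda>k. ?A k $$ 0" "\<lambda>k. ?B k $$ 0"
      using delay_chain_at nzk by (simp_all add: zorder_eq)
    have A0: "?A k $$ 0 = polyquot pa qa (z + of_int k)" if "\<bar>k\<bar> \<le> 5" for k
      using nzk[OF that] by (rule_tac expansion_polyquot_nth_0)
    have "polyquot pa qa z \<noteq> 0" using nzk[of 0] by simp
    then have "?A 2 $$ 0 + ?A (-2) $$ 0 \<noteq> ?A 0 $$ 0"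
      using elim(1) A0[of 2] A0[of "-2"] A0[of 0] by (simp add: add_divide_distrib[symmetric] del: divide_divide_eq_left divide_divide_eq_right)
    then show ?case using regular_at_distance_3 by fastforce
  qed
qed

text \<open>Reflection exchanges z + 1 with z - 1 and reverses the derivative. After multiplication
  by -1 the equation keeps its form, with coefficients a(-z) and -b(-z), so results for the right
  side transfer to the left.\<close>

lemma mirror: "delay_eq (\<lambda>z. w (- z)) (pcompose pa [:0, -1:]) (pcompose qa [:0, -1:])
   (- pcompose pb [:0, -1:]) (pcompose qb [:0, -1:])"
proof unfold_locales
  have cosparse_minus: "\<forall>\<^sub>\<approx>z. P (- z)" if "\<forall>\<^sub>\<approx>z. P z" for P :: "complex \<Rightarrow> bool"
  proof -
    have "eventually P (at (- x))" for x
      using that by (simp add: eventually_cosparse_open_eq)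
    then have "eventually (\<lambda>z. P (- z)) (at x)" for x
      using filtermap_at_minus[of x] by (metis eventually_filtermap)
    then show ?thesis by (simp add: eventually_cosparse_open_eq)
  qed
  show "(\<lambda>z. w (- z)) meromorphic_on UNIV"
    by (rule meromorphic_on_compose[OF mero]) (auto intro!: analytic_intros)
  show "\<forall>\<^sub>\<approx>z. w (- z) \<noteq> 0" using cosparse_minus[OF nz] .
  \<comment> \<open>The chain rule for w(-z) requires differentiability at -z, which holds off a
    sparse set.\<close>
  have "\<forall>\<^sub>\<approx>z. w analytic_on {- z}"
    using cosparse_minus[OF meromorphic_on_imp_analytic_cosparse[OF mero]] .
  then show "\<forall>\<^sub>\<approx>z. w (- (z + 1)) - w (- (z - 1)) + polyquot (pcompose pa [:0, -1:]) (pcompose qa [:0, -1:]) z *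
      (deriv (\<lambda>z. w (- z)) z / w (- z)) = polyquot (- pcompose pb [:0, -1:]) (pcompose qb [:0, -1:]) z"
    using cosparse_minus[OF eq]
  proof eventually_elim
    case (elim z)
    from elim(1) have "w field_differentiable at (- z)"
      by (simp add: analytic_on_imp_differentiable_at)
    then have "(w has_field_derivative deriv w (- z)) (at (- z))"
      by (simp add: field_differentiable_derivI)
    then have "((\<lambda>z. w (- z)) has_field_derivative (deriv w (- z) * (- 1))) (at z)"
      by (intro DERIV_chain2[where g = uminus]) (auto intro!: derivative_eq_intros)
    then have "deriv (\<lambda>z. w (- z)) z = - deriv w (- z)" by (simp add: DERIV_imp_deriv)
    moreover have "- (z + 1) = - z - 1" "- (z - 1) = - z + 1" by simp_all
    ultimately show ?case using elim(2)
      by (simp only: poly_pcompose poly_minus) (simp add: algebra_simps)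
  qed
qed (simp_all only: pcompose_neg_eq_0_iff pa qa qb not_False_eq_True)

text \<open>If one neighbour of the zero is not a pole, the run lies on the opposite side. If both
  are poles, one of the points at distance 3 is a pole and selects the side.\<close>

lemma eventually_pole_run:
  assumes nonconst: "(\<forall>c. pa \<noteq> smult c qa) \<or> (\<forall>c. pb \<noteq> smult c qb)"
  shows "eventually (\<lambda>z. zorder w z = 1 \<longrightarrow>
     pole_run (\<lambda>k. zorder w (z + of_int k)) \<or> pole_run (\<lambda>k. zorder w (z - of_int k))) at_infinity"
proof -
  interpret M: delay_eq "\<lambda>z. w (- z)" "pcompose pa [:0, -1:]" "pcompose qa [:0, -1:]"
    "- pcompose pb [:0, -1:]" "pcompose qb [:0, -1:]" by (rule mirror)
  have sm: "p = smult c q" if "pcompose p [:0, -1:] = smult c (pcompose q [:0, -1:])" for p q :: "complex poly" and c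
    using arg_cong[OF that, of "\<lambda>r. pcompose r [:0, -1:]"] by (simp only: pcompose_neg_involution pcompose_smult)
  have "(\<forall>c. pcompose pa [:0, -1:] \<noteq> smult c (pcompose qa [:0, -1:])) \<or>
        (\<forall>c. - pcompose pb [:0, -1:] \<noteq> smult c (pcompose qb [:0, -1:]))"
    using nonconst sm by (metis minus_equation_iff smult_minus_left)
  from M.eventually_pole_run_right[OF this]
  have "eventually (\<lambda>z. zorder w (- z) = 1 \<longrightarrow>
     zorder w (- (z - 1)) \<ge> 0 \<or> zorder w (- (z + 1)) < 0 \<and> zorder w (- (z + 3)) < 0 \<longrightarrow>
     pole_run (\<lambda>k. zorder w (- (z + of_int k)))) at_infinity"
    using mero by (simp add: zorder_uminus[OF meromorphic_on_subset] )
  \<comment> \<open>Neighbourhoods of infinity are symmetric, so z may be replaced by -z.\<close>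
  then have "eventually (\<lambda>z. zorder w (- (- z)) = 1 \<longrightarrow>
     zorder w (- ((- z) - 1)) \<ge> 0 \<or> zorder w (- ((- z) + 1)) < 0 \<and> zorder w (- ((- z) + 3)) < 0 \<longrightarrow>
     pole_run (\<lambda>k. zorder w (- ((- z) + of_int k)))) at_infinity"
    unfolding eventually_at_infinity by (metis norm_minus_cancel)
  then show ?thesis
    using eventually_pole_run_right[OF nonconst] eventually_poles_at_distance_3
  proof eventually_elim
    case (elim z)
    show ?case
    proof
      assume "zorder w z = 1"
      with elim show "pole_run (\<lambda>k. zorder w (z + of_int k)) \<or> pole_run (\<lambda>k. zorder w (z - of_int k))"
        by (simp add: algebra_simps) linarith
    qed
  qed
qed

end

section \<open>Growth dichotomy and conclusion\<close>

lemma constant_function_polyquot: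
  assumes "\<forall>\<^sub>\<approx>z. f z = polyquot (smult c q) q z" "q \<noteq> 0"
  shows "constant_function f"
proof -
  have "{z. poly q z = 0} sparse_in UNIV"
    by (intro finite_imp_sparse poly_roots_finite assms(2))
  then have "\<forall>\<^sub>\<approx>z. poly q z \<noteq> 0" by (simp add: eventually_cosparse)
  then have "\<forall>\<^sub>\<approx>z. f z = c" using assms(1) by eventually_elim simp
  then show ?thesis by (auto simp: constant_function_def)
qed

lemma eventually_ln_le_ln:
  fixes \<alpha> \<beta> \<gamma> :: real
  assumes "\<alpha> < \<beta>"
  shows "eventually (\<lambda>r. \<alpha> * ln r + \<gamma> \<le> \<beta> * ln r) at_top"
proof -
  have "filterlim (\<lambda>r::real. (\<beta> - \<alpha>) * ln r) at_top at_top"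
    using assms by (intro filterlim_tendsto_pos_mult_at_top[OF tendsto_const] ln_at_top) simp
  then have "eventually (\<lambda>r. \<gamma> \<le> (\<beta> - \<alpha>) * ln r) at_top"
    by (simp add: filterlim_at_top)
  then show ?thesis by eventually_elim (simp add: algebra_simps)
qed

text \<open>N(r) grows at least like n(b) (ln r - ln b), which for n(b) > C eventually exceeds C ln
  r.\<close>

lemma disc_count_bounded_if_slow:
  assumes "locally_finite_support \<mu>"
    and slow: "\<And>R. \<exists>r\<ge>R. integrated_count (disc_count \<mu>) r \<le> C * ln r"
  shows "real (disc_count \<mu> a) \<le> C"
proof (rule ccontr)
  define b where "b = max a 1"
  assume "\<not> real (disc_count \<mu> a) \<le> C"
  moreover have "disc_count \<mu> a \<le> disc_count \<mu> b" by (intro disc_count_mono assms(1)) (simp add: b_def)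
  ultimately have "C < real (disc_count \<mu> b)" by simp
  from eventually_ln_le_ln[OF this, of "real (disc_count \<mu> b) * ln b + 1"]
  obtain R where R: "\<And>r. R \<le> r \<Longrightarrow> C * ln r + (real (disc_count \<mu> b) * ln b + 1) \<le> real (disc_count \<mu> b) * ln r"
    unfolding eventually_at_top_linorder by blast
  obtain r where r: "r \<ge> max R b" "integrated_count (disc_count \<mu>) r \<le> C * ln r" using slow by blast
  have "integrated_count (disc_count \<mu>) b + real (disc_count \<mu> b) * (ln r - ln b) \<le> integrated_count (disc_count \<mu>) r"
    using r(1) by (intro integrated_count_ge assms(1)) (auto simp: b_def)
  moreover have "0 \<le> integrated_count (disc_count \<mu>) b"
    by (intro integrated_count_nonneg assms(1)) (simp add: b_def)
  ultimately show False using R[of r] r by (simp add: right_diff_distrib)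
qed

lemma integrated_count_superlogarithmic:
  assumes "locally_finite_support \<mu>" "\<not> (\<forall>a. real (disc_count \<mu> a) \<le> D)"
  shows "eventually (\<lambda>r. D * (ln r + 1) \<le> integrated_count (disc_count \<mu>) r) at_top"
proof -
  obtain a where a: "D < real (disc_count \<mu> a)" using assms(2) by (auto simp: not_le)
  define b where "b = max a 1"
  have "disc_count \<mu> a \<le> disc_count \<mu> b" by (intro disc_count_mono assms(1)) (simp add: b_def)
  then have "D < real (disc_count \<mu> b)" using a by simp
  from eventually_ln_le_ln[OF this, of "real (disc_count \<mu> b) * ln b + D"] eventually_ge_at_top[of b]
  show ?thesis
  proof eventually_elim
    case (elim r)
    have "integrated_count (disc_count \<mu>) b + real (disc_count \<mu> b) * (ln r - ln b) \<le> integrated_count (disc_count \<mu>) r"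
      using elim(2) by (intro integrated_count_ge assms(1)) (auto simp: b_def)
    moreover have "0 \<le> integrated_count (disc_count \<mu>) b"
      by (intro integrated_count_nonneg assms(1)) (simp add: b_def)
    ultimately show ?case using elim(1) by (simp add: algebra_simps)
  qed
qed

context nonzero_mero begin

lemma characteristic_ge: "integrated_count (disc_count pole_mult) r \<le> nevanlinna_T r w"
  using proximity_nonneg[of r] by (simp add: nevanlinna_T_def nevanlinna_N_eq)

lemma characteristic_ge_proximity:
  assumes "1 \<le> r"
  shows "proximity_fun r w \<le> nevanlinna_T r w"
  using integrated_count_nonneg[OF locally_finite(2) assms] by (simp add: nevanlinna_T_def nevanlinna_N_eq)

lemma countable_bad_radii: "countable (norm ` sing)"
  using sparse_imp_countable[OF open_UNIV sing_sparse] by (intro countable_image) simp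

text \<open>Along radii outside a set of finite logarithmic measure, the pole counting function would
  have to grow by a fixed factor whenever the radius increases by 5. If the number of poles is
  bounded, the same inequality makes \<open>w\<close> grow so slowly that it is rational.\<close>

lemma rational_if_poles_shifted:
  assumes E: "finite_log_measure E"
    and ho: "hyper_order w < 1"
    and \<epsilon>: "\<epsilon> > 0" and D: "D \<ge> 0"
    and le: "eventually (\<lambda>r. r \<notin> E \<longrightarrow> (1 + 2 * \<epsilon>) * nevanlinna_T r w \<le>
      (1 + \<epsilon> / 2) * integrated_count (disc_count pole_mult) (r + 5) + D * (ln r + 1)) at_top"
  shows "rational_function w"
proof -
  let ?N = "integrated_count (disc_count pole_mult)"
  define E' where "E' = E \<union> norm ` sing"
  have E': "finite_log_measure E'"
    unfolding E'_def by (intro finite_log_measure_Un_countable E countable_bad_radii)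
  note lf = locally_finite
  \<comment> \<open>Beyond this threshold N(r) dominates 2 D / \<epsilon> times ln r + 1, so the
    error term is at most \<epsilon> / 2 * N(r). The additional 1 keeps N(r) positive when D =
    0.\<close>
  have unbounded: False if "\<not> (\<forall>a. real (disc_count pole_mult a) \<le> 2 * D / \<epsilon> + 1)"
  proof -
    have ev1: "eventually (\<lambda>r. (2 * D / \<epsilon> + 1) * (ln r + 1) \<le> ?N r) at_top"
      by (rule integrated_count_superlogarithmic[OF lf(2) that])
    obtain \<sigma> where \<sigma>: "0 < \<sigma>" "\<sigma> < 1" "eventually (\<lambda>r. nevanlinna_T r w \<le> exp (r powr \<sigma>)) at_top"
      using hyper_order_less_1_bound[OF ho] by blast
    \<comment> \<open>Absorbing the error leaves the factor 1 + 2 \<epsilon> - \<epsilon> / 2, which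
      equals (1 + \<epsilon> / 2) (1 + \<eta>).\<close>
    define \<eta> where "\<eta> = \<epsilon> / (1 + \<epsilon> / 2)"
    have \<eta>: "\<eta> > 0" using \<epsilon> by (simp add: \<eta>_def)
    have "eventually (\<lambda>r. r \<ge> 1 \<and> ?N r > 0 \<and> ?N r \<le> exp (r powr \<sigma>) \<and> (r \<notin> E \<longrightarrow> (1 + \<eta>) * ?N r \<le> ?N (r + 5))) at_top"
      using ev1 \<sigma>(3) le eventually_ge_at_top[of 1]
    proof eventually_elim
      case (elim r)
      have lnr: "ln r \<ge> 0" using elim(4) by simp
      have "(2 * D / \<epsilon> + 1) * (ln r + 1) > 0"
        using lnr D \<epsilon> by (intro mult_pos_pos add_nonneg_pos) auto
      then have pos: "?N r > 0" using elim(1) by linarith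
      have "2 * D / \<epsilon> * (ln r + 1) \<le> (2 * D / \<epsilon> + 1) * (ln r + 1)"
        using lnr by (intro mult_right_mono) auto
      then have "2 * D / \<epsilon> * (ln r + 1) \<le> ?N r" using elim(1) by linarith
      then have D_le: "D * (ln r + 1) \<le> \<epsilon> / 2 * ?N r" using \<epsilon> by (simp add: field_simps)
      have grow: "(1 + \<eta>) * ?N r \<le> ?N (r + 5)" if "r \<notin> E"
      proof -
        have "(1 + 2 * \<epsilon>) * ?N r \<le> (1 + 2 * \<epsilon>) * nevanlinna_T r w"
          using \<epsilon> characteristic_ge[of r] by (intro mult_left_mono) auto
        also have "\<dots> \<le> (1 + \<epsilon> / 2) * ?N (r + 5) + D * (ln r + 1)" using elim(3) that by blast
        finally have "(1 + 2 * \<epsilon>) * ?N r \<le> (1 + \<epsilon> / 2) * ?N (r + 5) + \<epsilon> / 2 * ?N r"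
          using D_le by linarith
        then have "(1 + \<epsilon> / 2 + \<epsilon>) * ?N r \<le> (1 + \<epsilon> / 2) * ?N (r + 5)" by (simp add: algebra_simps)
        moreover have "(1 + \<epsilon> / 2 + \<epsilon>) = (1 + \<epsilon> / 2) * (1 + \<eta>)" using \<epsilon> by (simp add: \<eta>_def field_simps)
        ultimately have "(1 + \<epsilon> / 2) * ((1 + \<eta>) * ?N r) \<le> (1 + \<epsilon> / 2) * ?N (r + 5)" by (simp only: mult.assoc)
        then show ?thesis using \<epsilon> by (simp only: mult_le_cancel_left_pos)
      qed
      show ?case using elim pos grow characteristic_ge[of r] by (auto intro: order.trans)
    qed
    then obtain R0 where R0: "\<And>r. r \<ge> R0 \<Longrightarrow> r \<ge> 1 \<and> ?N r > 0 \<and> ?N r \<le> exp (r powr \<sigma>) \<and> (r \<notin> E \<longrightarrow> (1 + \<eta>) * ?N r \<le> ?N (r + 5))"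
      unfolding eventually_at_top_linorder by blast
    show False
    proof (rule geometric_growth_contradiction[OF E, of R0 ?N \<sigma> \<eta>])
      show "R0 \<ge> 1" "?N R0 > 0" using R0[of R0] by auto
      show "?N r \<le> ?N s" if "R0 \<le> r" "r \<le> s" for r s
        using R0[OF that(1)] that(2) by (intro integrated_count_mono lf) auto
    qed (use R0 \<sigma> \<eta> in auto)
  qed
  then have bdd: "\<And>a. real (disc_count pole_mult a) \<le> 2 * D / \<epsilon> + 1" by blast
  define K where "K = 2 * D / \<epsilon> + 1"
  have K: "\<And>a. real (disc_count pole_mult a) \<le> K" using bdd by (simp add: K_def)
  have K0: "K \<ge> 0" using D \<epsilon> by (simp add: K_def)
  define A where "A = (1 + \<epsilon> / 2) * ?N 1 + D"
  obtain C2 where C2: "\<And>r. 0 < r \<Longrightarrow> (\<And>z. norm z = r \<Longrightarrow> z \<notin> sing) \<Longrightarrow>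
    integrated_count (disc_count zero_mult) r \<le> nevanlinna_T r w + C2"
    by (rule zeros_le_characteristic) blast
  \<comment> \<open>The factor 2 comes from ln (r + 5) \<le> 2 ln r, and the last summand 1 absorbs
    the constant \<open>A\<close>.\<close>
  define C where "C = (1 + \<epsilon> / 2) * (K * 2) + D + 1"
  have "eventually (\<lambda>r. (C - 1) * ln r + A \<le> C * ln r) at_top"
    by (rule eventually_ln_le_ln) simp
  then have slow_ev: "eventually (\<lambda>r. r \<notin> E \<longrightarrow> nevanlinna_T r w \<le> C * ln r) at_top"
    using le eventually_ge_at_top[of 5]
  proof eventually_elim
    case (elim r)
    show ?case
    proof
      assume "r \<notin> E"
      have r: "r \<ge> 5" by (rule elim(3))
      have T0: "0 \<le> nevanlinna_T r w"
        using characteristic_ge[of r] integrated_count_nonneg[OF lf(2), of r] r by linarith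
      have "5 * r \<le> r * r" using r by (intro mult_right_mono) auto
      then have "r + 5 \<le> r * r" using r by linarith
      moreover have "0 < r + 5" "0 < r * r" using r by auto
      ultimately have "ln (r + 5) \<le> ln (r * r)" by (simp only: ln_le_cancel_iff)
      also have "ln (r * r) = ln r + ln r" using r by (intro ln_mult_pos) auto
      finally have "ln (r + 5) \<le> 2 * ln r" by simp
      then have "K * ln (r + 5) \<le> K * (2 * ln r)" using K0 by (rule mult_left_mono)
      moreover have "?N (r + 5) \<le> ?N 1 + K * ln (r + 5)"
        using r by (intro integrated_count_le_if_bounded lf K) auto
      ultimately have "?N (r + 5) \<le> ?N 1 + K * 2 * ln r" by simp
      then have "(1 + \<epsilon> / 2) * ?N (r + 5) \<le> (1 + \<epsilon> / 2) * (?N 1 + K * 2 * ln r)"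
        using \<epsilon> by (intro mult_left_mono) auto
      moreover have "nevanlinna_T r w \<le> (1 + 2 * \<epsilon>) * nevanlinna_T r w"
        using mult_right_mono[OF _ T0, of 1 "1 + 2 * \<epsilon>"] \<epsilon> by simp
      ultimately have "nevanlinna_T r w \<le> (1 + \<epsilon> / 2) * (?N 1 + K * 2 * ln r) + D * (ln r + 1)"
        using elim(2) \<open>r \<notin> E\<close> by linarith
      also have "\<dots> = (C - 1) * ln r + A" by (simp add: C_def A_def algebra_simps)
      finally show "nevanlinna_T r w \<le> C * ln r" using elim(1) by linarith
    qed
  qed
  have slow: "\<exists>r\<ge>R. r \<ge> 1 \<and> (\<forall>z. norm z = r \<longrightarrow> z \<notin> sing) \<and> nevanlinna_T r w \<le> C * ln r" for R
  proof -
    from slow_ev obtain R' where R': "\<And>r. r \<ge> R' \<Longrightarrow> r \<notin> E \<Longrightarrow> nevanlinna_T r w \<le> C * ln r"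
      unfolding eventually_at_top_linorder by blast
    obtain r where r: "r \<ge> max R (max R' 1)" "r \<notin> E'"
      using finite_log_measure_unbounded_compl[OF E'] by blast
    then show ?thesis using R'[of r] by (intro exI[of _ r]) (auto simp: E'_def)
  qed
  \<comment> \<open>The logarithmic bound on T passes to the zeros through N(r, 1/w) \<le> T(r, w) +
    O(1), so there are finitely many of these too.\<close>
  have "real (disc_count zero_mult a) \<le> C + 1" for a
  proof (rule disc_count_bounded_if_slow[OF lf(1)])
    fix R
    have "eventually (\<lambda>r. C * ln r + C2 \<le> (C + 1) * ln r) at_top" by (rule eventually_ln_le_ln) simp
    then obtain R' where R': "\<And>r. r \<ge> R' \<Longrightarrow> C * ln r + C2 \<le> (C + 1) * ln r"
      unfolding eventually_at_top_linorder by blast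
    obtain r where r: "r \<ge> max R R'" "r \<ge> 1" "\<forall>z. norm z = r \<longrightarrow> z \<notin> sing" "nevanlinna_T r w \<le> C * ln r"
      using slow by blast
    have "integrated_count (disc_count zero_mult) r \<le> nevanlinna_T r w + C2"
      using r by (intro C2) auto
    then show "\<exists>r\<ge>R. integrated_count (disc_count zero_mult) r \<le> (C + 1) * ln r"
      using r R'[of r] by (intro exI[of _ r]) auto
  qed
  then have "finite {s. zero_mult s \<noteq> 0}" by (rule finite_support_if_bounded[OF lf(1)])
  moreover have "finite {s. pole_mult s \<noteq> 0}" using K by (rule finite_support_if_bounded[OF lf(2)])
  moreover have "{z. zorder w z \<noteq> 0} = {s. zero_mult s \<noteq> 0} \<union> {s. pole_mult s \<noteq> 0}" by auto
  ultimately have fin: "finite {z. zorder w z \<noteq> 0}" by simp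
  show ?thesis
  proof (rule rational_if_slow_growth[OF fin])
    fix R
    obtain r where r: "r \<ge> R" "r \<ge> 1" "\<forall>z. norm z = r \<longrightarrow> z \<notin> sing" "nevanlinna_T r w \<le> C * ln r"
      using slow by blast
    then show "\<exists>r\<ge>R. (\<forall>z. norm z = r \<longrightarrow> z \<notin> sing) \<and> proximity_fun r w \<le> C * ln r"
      using characteristic_ge_proximity[of r] by (intro exI[of _ r]) auto
  qed
qed

end

theorem theorem1p2:
  fixes a b w :: "complex \<Rightarrow> complex" and \<epsilon> :: real and S :: "real \<Rightarrow> real"
  assumes "rational_function a" and "\<not> (\<forall>\<^sub>\<approx>z. a z = 0)"
    and "rational_function b"
    and "w meromorphic_on UNIV" and "\<not> rational_function w"
    and "\<forall>\<^sub>\<approx>z. w (z + 1) - w (z - 1) + a z * (deriv w z / w z) = b z"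
    and "hyper_order w < 1"
    and "\<epsilon> > 0"
    and "small_error S w"
    and "\<forall>\<^sub>F r in at_top.
           nevanlinna_Nbar r (\<lambda>z. 1 / w z) \<ge> (3 / 4 + \<epsilon>) * nevanlinna_T r w + S r"
  shows "constant_function a \<and> constant_function b"
proof (rule ccontr)
  assume nonconst: "\<not> (constant_function a \<and> constant_function b)"
  obtain pa qa where a: "qa \<noteq> 0" "\<forall>\<^sub>\<approx>z. a z = polyquot pa qa z"
    using assms(1) unfolding rational_function_def by blast
  obtain pb qb where b: "qb \<noteq> 0" "\<forall>\<^sub>\<approx>z. b z = polyquot pb qb z"
    using assms(3) unfolding rational_function_def by blast
  have "pa \<noteq> 0" using a assms(2) by auto
  \<comment> \<open>The zero function is rational. By the identity theorem \<open>w\<close> is then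
    nonzero off a sparse set, as division by \<open>w\<close> requires.\<close>
  have "\<not> (\<forall>\<^sub>\<approx>z. w z = 0)"
  proof
    assume "\<forall>\<^sub>\<approx>z. w z = 0"
    then have "\<forall>\<^sub>\<approx>z. w z = poly 0 z / poly 1 z" by simp
    moreover have "(1 :: complex poly) \<noteq> 0" by simp
    ultimately show False using assms(5) unfolding rational_function_def by blast
  qed
  then have nz: "\<forall>\<^sub>\<approx>z. w z \<noteq> 0"
    using meromorphic_imp_constant_or_avoid[OF assms(4) open_UNIV connected_UNIV, of 0] by blast
  have eq: "\<forall>\<^sub>\<approx>z. w (z + 1) - w (z - 1) + polyquot pa qa z * (deriv w z / w z) = polyquot pb qb z"
    using assms(6) a(2) b(2) by eventually_elim simp
  interpret delay_eq w pa qa pb qb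
    by unfold_locales (fact assms(4) nz \<open>pa \<noteq> 0\<close> a(1) b(1) eq)+
  have "(\<forall>c. pa \<noteq> smult c qa) \<or> (\<forall>c. pb \<noteq> smult c qb)"
    using nonconst constant_function_polyquot a b by metis
  from eventually_pole_run[OF this] obtain R where
    R: "\<And>z. R \<le> norm z \<Longrightarrow> zorder w z = 1 \<Longrightarrow>
      pole_run (\<lambda>k. zorder w (z + of_int k)) \<or> pole_run (\<lambda>k. zorder w (z - of_int k))"
    unfolding eventually_at_infinity by blast
  obtain C1 where C1: "\<And>r. 4 * disc_count (\<lambda>z. if zorder w z > 0 then 1 else 0) r \<le>
    2 * disc_count zero_mult r + disc_count pole_mult (r + 5) + C1"
    by (rule disc_count_inequality[OF finite_zorder_nonzero R]) blast+
  obtain D where D: "D \<ge> 0" "\<And>r. 1 \<le> r \<Longrightarrow>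
    4 * integrated_count (disc_count (\<lambda>z. if zorder w z > 0 then 1 else 0)) r \<le>
      2 * integrated_count (disc_count zero_mult) r
      + (1 + \<epsilon> / 2) * integrated_count (disc_count pole_mult) (r + 5) + D * (ln r + 1)"
    by (rule integrated_count_inequality[OF locally_finite(3,1,2) C1, of "\<epsilon> / 2"]) (use assms(8) in auto)
  obtain C2 where C2: "\<And>r. 0 < r \<Longrightarrow> (\<And>z. norm z = r \<Longrightarrow> z \<notin> sing) \<Longrightarrow>
    integrated_count (disc_count zero_mult) r \<le> nevanlinna_T r w + C2"
    by (rule zeros_le_characteristic) blast
  obtain E where E: "finite_log_measure E"
    "S \<in> o[inf at_top (principal (- E))](\<lambda>r. nevanlinna_T r w)"
    using assms(9) unfolding small_error_def by blast
  have "eventually (\<lambda>r. norm (S r) \<le> \<epsilon> / 2 * norm (nevanlinna_T r w)) (inf at_top (principal (- E)))"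
    using landau_o.smallD[OF E(2), of "\<epsilon> / 2"] assms(8) by simp
  then have small: "eventually (\<lambda>r. r \<notin> E \<longrightarrow> \<bar>S r\<bar> \<le> \<epsilon> / 2 * \<bar>nevanlinna_T r w\<bar>) at_top"
    by (simp add: eventually_inf_principal)
  \<comment> \<open>The zero count enters with the factor 2, and its constant is absorbed since ln r
    + 1 \<ge> 1.\<close>
  define D' where "D' = D + 2 * \<bar>C2\<bar>"
  have "rational_function w"
  proof (rule rational_if_poles_shifted[where D = D'])
    \<comment> \<open>Circles that meet \<open>sing\<close> are excluded because the estimate
      \<open>C2\<close> applies only to the others.\<close>
    show "finite_log_measure (E \<union> norm ` sing)"
      by (intro finite_log_measure_Un_countable E countable_bad_radii)
    show "D' \<ge> 0" using D(1) by (simp add: D'_def)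
    show "eventually (\<lambda>r. r \<notin> E \<union> norm ` sing \<longrightarrow> (1 + 2 * \<epsilon>) * nevanlinna_T r w \<le>
      (1 + \<epsilon> / 2) * integrated_count (disc_count pole_mult) (r + 5) + D' * (ln r + 1)) at_top"
      using small assms(10) eventually_ge_at_top[of 1]
    proof eventually_elim
      case (elim r)
      show ?case
      proof
        assume r: "r \<notin> E \<union> norm ` sing"
        let ?T = "nevanlinna_T r w"
        have T0: "0 \<le> ?T"
          using characteristic_ge[of r] integrated_count_nonneg[OF locally_finite(2) elim(3)] by linarith
        have "\<bar>S r\<bar> \<le> \<epsilon> / 2 * ?T" using elim(1) r T0 by simp
        then have "(3 / 4 + \<epsilon>) * ?T - \<epsilon> / 2 * ?T \<le>
            integrated_count (disc_count (\<lambda>z. if zorder w z > 0 then 1 else 0)) r"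
          using elim(2) unfolding nevanlinna_Nbar_inverse_eq by linarith
        moreover have "integrated_count (disc_count zero_mult) r \<le> ?T + \<bar>C2\<bar>"
          using C2[of r] elim(3) r by force
        moreover have "2 * \<bar>C2\<bar> \<le> 2 * \<bar>C2\<bar> * (ln r + 1)" using elim(3) by (simp add: mult_le_cancel_left1)
        moreover have "D' * (ln r + 1) = D * (ln r + 1) + 2 * \<bar>C2\<bar> * (ln r + 1)"
          by (simp only: D'_def distrib_right)
        \<comment> \<open>The coefficient of T is 4 (3/4 + \<epsilon>) - 2 \<epsilon> - 2 = 1 + 2
          \<epsilon>, the terms subtracted being the error S and the zeros with
          multiplicity.\<close>
        ultimately show "(1 + 2 * \<epsilon>) * ?T \<le> (1 + \<epsilon> / 2) * integrated_count (disc_count pole_mult) (r + 5) + D' * (ln r + 1)"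
          using D(2)[OF elim(3)] by (simp only: distrib_right)
      qed
    qed
  qed (use assms in auto)
  then show False using assms(5) by blast
qed

end
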